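(* Let $\mathbb{F}$ be a field of characteristic $0$, let $A$ be an abelian group, $T$ a vector space over $\mathbb{F}$, and $\varphi: T\times A\to\mathbb{F}$ a map that is $\mathbb{F}$-linear in the first variable and additive in the second, such that the generalized Witt algebra $W(A,T,\varphi)$ is a simple Lie algebra. Then every invertible (i.e. bijective) $2$-local automorphism $\Phi: W(A,T,\varphi)\to W(A,T,\varphi)$ (not assumed linear) is an automorphism of the Lie algebra $W(A,T,\varphi)$.
   Context: Generalized Witt algebra: given an abelian group $A$, a field $\mathbb{F}$, an $\mathbb{F}$-vector space $T$ and a map $\varphi:T\times A\to\mathbb{F}$ that is $\mathbb{F}$-linear in the first variable and additive in the second, let $\mathbb{F}A$ be the group algebra with basis $t^\alpha$ ($\alpha\in A$), $t^\alpha t^\beta=t^{\alpha+\beta}$. Then $W(A,T,\varphi)=\mathbb{F}A\otimes_{\mathbb{F}}T$, with $t^\alpha\partial:=t^\alpha\otimes\partial$, is the Lie algebra over $\mathbb{F}$ with bracket $$[t^\alpha\partial,t^\beta\partial']=t^{\alpha+\beta}\big(\varphi(\partial,\beta)\partial'-\varphi(\partial',\alpha)\partial\big),\quad \alpha,\beta\in A,\ \partial,\partial'\in T.$$ (In characteristic $0$ it is known that $W(A,T,\varphi)$ is simple if and only if $A\ne 0$ and $\varphi$ is nondegenerate, i.e. $\varphi(\partial,\alpha)=0$ for all $\partial\in T$ implies $\alpha=0$, and $\varphi(\partial,\alpha)=0$ for all $\alpha\in A$ implies $\partial=0$.) An automorphism of a Lie algebra $L$ is an invertible linear map $\theta:L\to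 L$ with $\theta([x,y])=[\theta(x),\theta(y)]$ for all $x,y\in L$. A map $\Phi:L\to L$ (not necessarily linear) is a $2$-local automorphism if for every $x,y\in L$ there is an automorphism $\theta_{x,y}$ of $L$ with $\Phi(x)=\theta_{x,y}(x)$ and $\Phi(y)=\theta_{x,y}(y)$. *)

theory Defs
  imports Complex_Main "HOL-Library.Poly_Mapping"
begin

section \<open>Lie algebras\<close>

locale lie_algebra = vector_space scale
  for scale :: "'f::field \<Rightarrow> 'l::ab_group_add \<Rightarrow> 'l"
  and br :: "'l \<Rightarrow> 'l \<Rightarrow> 'l" +
  assumes linear_left: "Vector_Spaces.linear scale scale (\<lambda>x. br x y)"
    and linear_right: "Vector_Spaces.linear scale scale (br x)"
    and alternating: "br x x = 0"
    and jacobi: "br x (br y z) + br y (br z x) + br z (br x y) = 0"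

definition lie_ideal ::
  "('f::field \<Rightarrow> 'l::ab_group_add \<Rightarrow> 'l) \<Rightarrow> ('l \<Rightarrow> 'l \<Rightarrow> 'l) \<Rightarrow> 'l set \<Rightarrow> bool"
  where "lie_ideal scale br I \<longleftrightarrow>
    module.subspace scale I \<and> (\<forall>x. \<forall>y\<in>I. br x y \<in> I)"

(* Simple Lie algebras are non-abelian by convention, which excludes the zero algebra
   and the one-dimensional algebra. *)
definition simple_lie_algebra ::
  "('f::field \<Rightarrow> 'l::ab_group_add \<Rightarrow> 'l) \<Rightarrow> ('l \<Rightarrow> 'l \<Rightarrow> 'l) \<Rightarrow> bool"
  where "simple_lie_algebra scale br \<longleftrightarrow>
    lie_algebra scale br \<and> (\<exists>x y. br x y \<noteq> 0) \<and>
    (\<forall>I. lie_ideal scale br I \<longrightarrow> I = {0} \<or> I = UNIV)"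

definition lie_automorphism ::
  "('f::field \<Rightarrow> 'l::ab_group_add \<Rightarrow> 'l) \<Rightarrow> ('l \<Rightarrow> 'l \<Rightarrow> 'l) \<Rightarrow> ('l \<Rightarrow> 'l) \<Rightarrow> bool"
  where "lie_automorphism scale br \<theta> \<longleftrightarrow>
    Vector_Spaces.linear scale scale \<theta> \<and> bij \<theta> \<and> (\<forall>x y. \<theta> (br x y) = br (\<theta> x) (\<theta> y))"

definition two_local_automorphism ::
  "('f::field \<Rightarrow> 'l::ab_group_add \<Rightarrow> 'l) \<Rightarrow> ('l \<Rightarrow> 'l \<Rightarrow> 'l) \<Rightarrow> ('l \<Rightarrow> 'l) \<Rightarrow> bool"
  where "two_local_automorphism scale br \<Phi> \<longleftrightarrow>
    (\<forall>x y. \<exists>\<theta>. lie_automorphism scale br \<theta> \<and> \<Phi> x = \<theta> x \<and> \<Phi> y = \<theta> y)"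

section \<open>Generalized Witt algebras\<close>

(* Since the group algebra is free on the t^alpha, its tensor product with T is the direct
   sum of copies t^alpha T of T indexed by A, i.e. the type of finitely supported functions
   from A to T; the element t^alpha d is Poly_Mapping.single alpha d. *)

definition witt_scale ::
  "('f::field \<Rightarrow> 't::ab_group_add \<Rightarrow> 't) \<Rightarrow> 'f \<Rightarrow> ('a \<Rightarrow>\<^sub>0 't) \<Rightarrow> ('a \<Rightarrow>\<^sub>0 't)"
  where "witt_scale scale c x = Poly_Mapping.map (scale c) x"

(* The bilinear extension of the bracket of basis tensors, see bracket_single and
   witt_lie_algebra below. *)
definition witt_bracket ::
  "('f::field \<Rightarrow> 't::ab_group_add \<Rightarrow> 't) \<Rightarrow> ('t \<Rightarrow> 'a::ab_group_add \<Rightarrow> 'f) \<Rightarrow>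
    ('a \<Rightarrow>\<^sub>0 't) \<Rightarrow> ('a \<Rightarrow>\<^sub>0 't) \<Rightarrow> ('a \<Rightarrow>\<^sub>0 't)"
  where "witt_bracket scale \<phi> x y =
    (\<Sum>\<alpha>\<in>Poly_Mapping.keys x. \<Sum>\<beta>\<in>Poly_Mapping.keys y.
      Poly_Mapping.single (\<alpha> + \<beta>)
        (scale (\<phi> (Poly_Mapping.lookup x \<alpha>) \<beta>) (Poly_Mapping.lookup y \<beta>)
         - scale (\<phi> (Poly_Mapping.lookup y \<beta>) \<alpha>) (Poly_Mapping.lookup x \<alpha>)))"

locale witt_datum = vector_space scale
  for scale :: "'f::field \<Rightarrow> 't::ab_group_add \<Rightarrow> 't"
  and \<phi> :: "'t \<Rightarrow> 'a::ab_group_add \<Rightarrow> 'f" +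
  assumes linear_fst: "Vector_Spaces.linear scale (*) (\<lambda>d. \<phi> d \<alpha>)"
    and additive_snd: "\<phi> d (\<alpha> + \<beta>) = \<phi> d \<alpha> + \<phi> d \<beta>"
begin

lemma phi_add: "\<phi> (d + e) \<alpha> = \<phi> d \<alpha> + \<phi> e \<alpha>"
  using linear_fst[of \<alpha>] by (simp add: Vector_Spaces.linear_iff)

lemma phi_scale: "\<phi> (scale c d) \<alpha> = c * \<phi> d \<alpha>"
  using linear_fst[of \<alpha>] by (simp add: Vector_Spaces.linear_iff)

lemma phi_0: "\<phi> 0 \<alpha> = 0"
  using phi_add[of 0 0 \<alpha>] by (metis add.right_neutral add_left_cancel)

lemma phi_diff: "\<phi> (d - e) \<alpha> = \<phi> d \<alpha> - \<phi> e \<alpha>"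
  using phi_add[of "d - e" e \<alpha>] by simp

abbreviation "wscale \<equiv> witt_scale scale"
abbreviation "wbr \<equiv> witt_bracket scale \<phi>"

lemma lookup_witt_scale [simp]:
  "Poly_Mapping.lookup (wscale c x) k = scale c (Poly_Mapping.lookup x k)"
  by (simp add: witt_scale_def Poly_Mapping.map.rep_eq when_def)

lemma witt_scale_single:
  "wscale c (Poly_Mapping.single \<alpha> d) = Poly_Mapping.single \<alpha> (scale c d)"
  by (rule poly_mapping_eqI) (simp add: lookup_single when_def)

lemma vector_space_witt_scale: "vector_space (wscale :: 'f \<Rightarrow> ('a \<Rightarrow>\<^sub>0 't) \<Rightarrow> _)"
  by unfold_locales
    (rule poly_mapping_eqI, simp add: lookup_add scale_left_distrib scale_right_distrib)+

lemma witt_bracket_superset: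
  assumes "finite S" "finite S'" "Poly_Mapping.keys x \<subseteq> S" "Poly_Mapping.keys y \<subseteq> S'"
  shows "wbr x y = (\<Sum>\<alpha>\<in>S. \<Sum>\<beta>\<in>S'. Poly_Mapping.single (\<alpha> + \<beta>)
        (scale (\<phi> (Poly_Mapping.lookup x \<alpha>) \<beta>) (Poly_Mapping.lookup y \<beta>)
         - scale (\<phi> (Poly_Mapping.lookup y \<beta>) \<alpha>) (Poly_Mapping.lookup x \<alpha>)))"
proof -
  let ?f = "\<lambda>\<alpha> \<beta>. Poly_Mapping.single (\<alpha> + \<beta>)
        (scale (\<phi> (Poly_Mapping.lookup x \<alpha>) \<beta>) (Poly_Mapping.lookup y \<beta>)
         - scale (\<phi> (Poly_Mapping.lookup y \<beta>) \<alpha>) (Poly_Mapping.lookup x \<alpha>))"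
  have "wbr x y = (\<Sum>\<alpha>\<in>Poly_Mapping.keys x. \<Sum>\<beta>\<in>S'. ?f \<alpha> \<beta>)"
    unfolding witt_bracket_def
    by (intro sum.cong refl sum.mono_neutral_left)
      (use assms in \<open>auto simp: in_keys_iff phi_0\<close>)
  also have "\<dots> = (\<Sum>\<alpha>\<in>S. \<Sum>\<beta>\<in>S'. ?f \<alpha> \<beta>)"
    by (intro sum.mono_neutral_left)
      (use assms in \<open>auto simp: in_keys_iff phi_0\<close>)
  finally show ?thesis .
qed

lemma bracket_single:
  "wbr (Poly_Mapping.single \<alpha> d) (Poly_Mapping.single \<beta> e) =
     Poly_Mapping.single (\<alpha> + \<beta>) (scale (\<phi> d \<beta>) e - scale (\<phi> e \<alpha>) d)"
  by (subst witt_bracket_superset[of "{\<alpha>}" "{\<beta>}"]) auto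

lemma bracket_add_left: "wbr (x + y) z = wbr x z + wbr y z"
proof -
  let ?S = "Poly_Mapping.keys x \<union> Poly_Mapping.keys y" and ?S' = "Poly_Mapping.keys z"
  have eqs: "Poly_Mapping.keys (x + y) \<subseteq> ?S" by (rule keys_add)
  show ?thesis
    by (subst (1 2 3) witt_bracket_superset[of ?S ?S'])
      (use eqs in \<open>auto simp flip: sum.distrib single_add
        simp: lookup_add phi_add scale_left_distrib scale_right_distrib algebra_simps\<close>)
qed

lemma bracket_antisym: "wbr x y = - wbr y x"
proof -
  have "wbr y x = (\<Sum>\<alpha>\<in>Poly_Mapping.keys x. \<Sum>\<beta>\<in>Poly_Mapping.keys y. Poly_Mapping.single (\<beta> + \<alpha>)
        (scale (\<phi> (Poly_Mapping.lookup y \<beta>) \<alpha>) (Poly_Mapping.lookup x \<alpha>)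
         - scale (\<phi> (Poly_Mapping.lookup x \<alpha>) \<beta>) (Poly_Mapping.lookup y \<beta>)))"
    unfolding witt_bracket_def by (rule sum.swap)
  then show ?thesis
    unfolding witt_bracket_def[of _ _ x y]
    by (simp flip: sum_negf single_uminus add: add.commute)
qed

lemma bracket_add_right: "wbr z (x + y) = wbr z x + wbr z y"
  by (subst (1 2 3) bracket_antisym) (simp add: bracket_add_left)

lemma bracket_0 [simp]: "wbr 0 x = 0" "wbr x 0 = 0"
  by (simp_all add: witt_bracket_def)

lemma bracket_scale_left: "wbr (wscale c x) y = wscale c (wbr x y)"
proof -
  interpret W: vector_space "wscale :: 'f \<Rightarrow> ('a \<Rightarrow>\<^sub>0 't) \<Rightarrow> _"
    by (rule vector_space_witt_scale)
  have "Poly_Mapping.keys (wscale c x) \<subseteq> Poly_Mapping.keys x"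
    by (auto simp: in_keys_iff)
  then show ?thesis
    by (subst (1 2) witt_bracket_superset[of "Poly_Mapping.keys x" "Poly_Mapping.keys y"])
      (auto simp: W.scale_sum_right witt_scale_single phi_scale scale_right_diff_distrib
        scale_left_commute mult.commute)
qed

lemma bracket_scale_right: "wbr y (wscale c x) = wscale c (wbr y x)"
proof -
  interpret W: vector_space "wscale :: 'f \<Rightarrow> ('a \<Rightarrow>\<^sub>0 't) \<Rightarrow> _"
    by (rule vector_space_witt_scale)
  show ?thesis
    by (subst (1 2) bracket_antisym) (simp add: bracket_scale_left)
qed

lemma poly_mapping_add_induct [case_names zero add]:
  fixes x :: "'a \<Rightarrow>\<^sub>0 't"
  assumes "P 0" "\<And>\<alpha> d x. P x \<Longrightarrow> P (Poly_Mapping.single \<alpha> d + x)"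
  shows "P x"
proof (induction x rule: update_induct)
  case const
  then show ?case using assms by simp
next
  case (update f a b)
  have "Poly_Mapping.update a b f = Poly_Mapping.single a b + f"
    by (rule poly_mapping_eqI)
      (use update in \<open>auto simp: lookup_update lookup_add lookup_single when_def in_keys_iff\<close>)
  then show ?case using assms update by simp
qed

lemma bracket_self: "wbr x x = 0"
proof (induction x rule: poly_mapping_add_induct)
  case (add \<alpha> d x)
  have "wbr x (Poly_Mapping.single \<alpha> d) = - wbr (Poly_Mapping.single \<alpha> d) x"
    by (rule bracket_antisym)
  with add show ?case
    by (simp add: bracket_add_left bracket_add_right bracket_single)
qed simp

lemma phi_0_right: "\<phi> d 0 = 0"
  using additive_snd[of d 0 0] by (metis add.right_neutral add_left_cancel)

lemma bracket_jacobi: "wbr x (wbr y z) + wbr y (wbr z x) + wbr z (wbr x y) = 0"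
proof (induction x rule: poly_mapping_add_induct)
  case (add \<alpha> d x)
  have "wbr (Poly_Mapping.single \<alpha> d) (wbr y z) + wbr y (wbr z (Poly_Mapping.single \<alpha> d))
      + wbr z (wbr (Poly_Mapping.single \<alpha> d) y) = 0"
  proof (induction y rule: poly_mapping_add_induct)
    case (add \<beta> e y)
    have "wbr (Poly_Mapping.single \<alpha> d) (wbr (Poly_Mapping.single \<beta> e) z)
      + wbr (Poly_Mapping.single \<beta> e) (wbr z (Poly_Mapping.single \<alpha> d))
      + wbr z (wbr (Poly_Mapping.single \<alpha> d) (Poly_Mapping.single \<beta> e)) = 0"
    proof (induction z rule: poly_mapping_add_induct)
      case (add \<gamma> f z)
      have "wbr (Poly_Mapping.single \<alpha> d) (wbr (Poly_Mapping.single \<beta> e) (Poly_Mapping.single \<gamma> f))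
        + wbr (Poly_Mapping.single \<beta> e) (wbr (Poly_Mapping.single \<gamma> f) (Poly_Mapping.single \<alpha> d))
        + wbr (Poly_Mapping.single \<gamma> f) (wbr (Poly_Mapping.single \<alpha> d) (Poly_Mapping.single \<beta> e)) = 0"
        by (simp add: bracket_single ac_simps flip: single_add)
          (simp add: phi_diff phi_scale additive_snd scale_right_diff_distrib
            scale_left_diff_distrib scale_left_distrib scale_right_distrib algebra_simps)
      with add show ?case
        by (simp add: bracket_add_left bracket_add_right algebra_simps add_eq_0_iff)
    qed simp
    with add show ?case
      by (simp add: bracket_add_left bracket_add_right algebra_simps add_eq_0_iff)
  qed simp
  with add show ?case
    by (simp add: bracket_add_left bracket_add_right algebra_simps add_eq_0_iff)
qed simp

theorem witt_lie_algebra: "lie_algebra wscale wbr"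
proof -
  interpret W: vector_space "wscale :: 'f \<Rightarrow> ('a \<Rightarrow>\<^sub>0 't) \<Rightarrow> _"
    by (rule vector_space_witt_scale)
  show ?thesis
    by unfold_locales
      (simp_all add: bracket_add_left bracket_add_right bracket_scale_left bracket_scale_right
        bracket_self bracket_jacobi)
qed

end

end

theory Submission
  imports Defs
begin

text \<open>
  Simplicity makes \<open>\<phi>\<close> nondegenerate, hence \<open>A\<close> torsion-free. The proof rests on two facts.

  The first is the description of \<open>Aut W\<close> (\<open>automorphism_monomial\<close>): every automorphism has the form
  \<open>t\<^sup>\<alpha> d \<mapsto> \<chi>(\<alpha>) t\<^sup>\<sigma>\<^sup>(\<^sup>\<alpha>\<^sup>) \<tau>(d)\<close> with a character \<open>\<chi>\<close> and with \<open>\<sigma>\<close>, \<open>\<tau>\<close> adjoint under \<open>\<phi>\<close>. A torsion-free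
  abelian group carries a total order, so elements of \<open>W\<close> have leading terms. If \<open>x\<close> has leading term
  \<open>t\<^sup>\<gamma> u\<close> with \<open>\<gamma> \<noteq> 0\<close>, then for a suitable \<open>\<beta>\<close> the leading terms of \<open>(ad x)\<^sup>n (t\<^sup>\<beta> u)\<close> sit in
  the infinitely many degrees \<open>\<beta> + n\<gamma>\<close>; therefore locally ad-finite elements lie in the torus
  \<open>T = t\<^sup>0 T\<close>. Automorphisms preserve local ad-finiteness, hence the torus, and they permute its
  weight spaces \<open>t\<^sup>\<alpha> T\<close>. What remains on each weight space is shown to be a scalar
  by comparing the brackets of degrees \<open>\<plusminus>\<alpha>\<close> and \<open>\<plusminus>\<beta>\<close> (\<open>g_scalar\<close>).

  The second is that a \<open>2\<close>-local automorphism \<open>\<Phi>\<close> has a global \<open>\<sigma>\<close>, \<open>\<tau>\<close> and \<open>\<chi>\<close>. The values of \<open>\<Phi>\<close> on the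
  torus and the degrees of the \<open>\<Phi>(t\<^sup>\<alpha> d)\<close> give maps \<open>R\<close> and \<open>S\<close> with
  \<open>\<phi>(R d, S \<alpha>) = \<phi>(d, \<alpha>)\<close>. Since \<open>\<Phi>\<close> is surjective, so are \<open>R\<close> and \<open>S\<close>, and nondegeneracy turns this
  identity into additivity of both. An arbitrary element \<open>x\<close> has only finitely many
  degrees and coefficients, so they are controlled by one probe: the sum of the
  \<open>t\<^sup>\<alpha> d\<close> over a large finite set of degrees \<open>\<alpha>\<close>, including \<open>0\<close>, with \<open>d\<close> generic. An automorphism that
  agrees with \<open>\<Phi>\<close> on the probe and on \<open>x\<close> has to move these degrees by \<open>S\<close> and
  the coefficients of \<open>x\<close> by \<open>R\<close>, up to a character. Two elements can share a probe, so the
  character is the same for all elements (\<open>common_character\<close>).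
\<close>

section \<open>Simplicity forces nondegeneracy\<close>

primrec nat_multiple :: "nat \<Rightarrow> 'a::ab_group_add \<Rightarrow> 'a" where
  "nat_multiple 0 a = 0"
| "nat_multiple (Suc n) a = a + nat_multiple n a"

lemma nat_multiple_add: "nat_multiple (m + n) a = nat_multiple m a + nat_multiple n a"
  by (induction m) (auto simp: algebra_simps)

lemma nat_multiple_mult: "nat_multiple (m * n) a = nat_multiple m (nat_multiple n a)"
  by (induction m) (auto simp: nat_multiple_add)

lemma nat_multiple_uminus: "nat_multiple n (- a) = - nat_multiple n a"
  by (induction n) auto

lemma nat_multiple_mem:
  assumes "0 \<in> P" "\<And>a b. a \<in> P \<Longrightarrow> b \<in> P \<Longrightarrow> a + b \<in> P" "a \<in> P"
  shows "nat_multiple n a \<in> P"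
  by (induction n) (use assms in auto)

context witt_datum
begin

lemma phi_uminus: "\<phi> (- d) \<alpha> = - \<phi> d \<alpha>"
  using phi_diff[of 0 d \<alpha>] by (simp add: phi_0)

lemma phi_uminus_right: "\<phi> d (- \<alpha>) = - \<phi> d \<alpha>"
  using additive_snd[of d \<alpha> "- \<alpha>"] by (simp add: phi_0_right eq_neg_iff_add_eq_0 add.commute)

lemma phi_diff_right: "\<phi> d (\<alpha> - \<beta>) = \<phi> d \<alpha> - \<phi> d \<beta>"
  using additive_snd[of d \<alpha> "- \<beta>"] by (simp add: phi_uminus_right)

lemma phi_nat_multiple: "\<phi> d (nat_multiple n \<alpha>) = of_nat n * \<phi> d \<alpha>"
  by (induction n) (auto simp: phi_0_right additive_snd algebra_simps)

lemmas phi_simps = phi_add phi_scale phi_0 phi_diff phi_uminus additive_snd phi_0_right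
  phi_uminus_right phi_diff_right phi_nat_multiple

text \<open>Elements all of whose coefficients lie in the left radical of \<open>\<phi>\<close> form an ideal.
  It cannot be everything, since then the bracket would vanish.\<close>

lemma simple_imp_nondegenerate_left:
  assumes simple: "simple_lie_algebra wscale wbr" and d: "\<And>\<alpha>. \<phi> d \<alpha> = 0"
  shows "d = 0"
proof -
  interpret W: vector_space "wscale :: 'f \<Rightarrow> ('a \<Rightarrow>\<^sub>0 't) \<Rightarrow> _"
    by (rule vector_space_witt_scale)
  define K where "K = {d. \<forall>\<alpha>. \<phi> d \<alpha> = 0}"
  define I :: "('a \<Rightarrow>\<^sub>0 't) set" where "I = {x. \<forall>\<alpha>. Poly_Mapping.lookup x \<alpha> \<in> K}"
  have sub: "W.subspace I"
    unfolding W.subspace_def I_def K_def by (auto simp: lookup_add phi_simps)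
  have "wbr x y \<in> I" if "y \<in> I" for x y
  proof -
    have "Poly_Mapping.single (\<alpha> + \<beta>)
        (scale (\<phi> (Poly_Mapping.lookup x \<alpha>) \<beta>) (Poly_Mapping.lookup y \<beta>)
         - scale (\<phi> (Poly_Mapping.lookup y \<beta>) \<alpha>) (Poly_Mapping.lookup x \<alpha>)) \<in> I" for \<alpha> \<beta>
      using that by (auto simp: I_def K_def lookup_single when_def phi_simps)
    then show ?thesis
      unfolding witt_bracket_def by (intro W.subspace_sum[OF sub])
  qed
  with sub have "lie_ideal wscale wbr I" by (simp add: lie_ideal_def)
  then consider "I = {0}" | "I = UNIV" using simple by (auto simp: simple_lie_algebra_def)
  then show ?thesis
  proof cases
    case 1
    have "Poly_Mapping.single 0 d \<in> I"
      using d by (auto simp: I_def K_def lookup_single when_def phi_0)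
    with 1 have "Poly_Mapping.single (0::'a) d = 0" by simp
    then show ?thesis by (metis lookup_single_eq lookup_zero)
  next
    case 2
    have "\<phi> e \<alpha> = 0" for e \<alpha>
      using 2 lookup_single_eq[of 0 e] unfolding I_def K_def by (metis (mono_tags, lifting) UNIV_I mem_Collect_eq)
    then have "wbr x y = 0" for x y by (simp add: witt_bracket_def)
    with simple show ?thesis by (auto simp: simple_lie_algebra_def)
  qed
qed

text \<open>If \<open>\<phi>(_, \<alpha>) = 0\<close>, then multiplication by \<open>t\<^sup>\<alpha>\<close> commutes with all brackets, so
  \<open>(t\<^sup>\<alpha> - 1) W\<close> is an ideal. It is proper because the sum of all coefficients vanishes on it,
  and nonzero unless \<open>\<alpha> = 0\<close>.\<close>

lemma simple_imp_nondegenerate_right: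
  assumes simple: "simple_lie_algebra wscale wbr" and \<alpha>: "\<And>d. \<phi> d \<alpha> = 0"
  shows "\<alpha> = 0"
proof -
  interpret W: vector_space "wscale :: 'f \<Rightarrow> ('a \<Rightarrow>\<^sub>0 't) \<Rightarrow> _"
    by (rule vector_space_witt_scale)
  have "\<exists>d::'t. d \<noteq> 0"
  proof (rule ccontr)
    assume "\<not> (\<exists>d::'t. d \<noteq> 0)"
    then have "x = 0" for x :: "'a \<Rightarrow>\<^sub>0 't" by (intro poly_mapping_eqI) auto
    then show False using simple by (metis simple_lie_algebra_def)
  qed
  then obtain d :: 't where d: "d \<noteq> 0" by blast
  define B where "B = {Poly_Mapping.single (\<beta> + \<alpha>) e - Poly_Mapping.single \<beta> e | \<beta> (e::'t). True}"
  define I where "I = W.span B"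
  have sub: "W.subspace I" by (simp add: I_def)
  have ideal1: "wbr x b \<in> I" if "b \<in> B" for x b
  proof -
    obtain \<beta> e where b: "b = Poly_Mapping.single (\<beta> + \<alpha>) e + Poly_Mapping.single \<beta> (- e)"
      using \<open>b \<in> B\<close> unfolding B_def by (auto simp: single_uminus)
    show ?thesis
    proof (induction x rule: poly_mapping_add_induct)
      case zero
      then show ?case by (simp add: I_def W.span_zero)
    next
      case (add \<gamma> f x)
      let ?v = "scale (\<phi> f \<beta>) e - scale (\<phi> e \<gamma>) f"
      have "wbr (Poly_Mapping.single \<gamma> f) b
          = Poly_Mapping.single ((\<gamma> + \<beta>) + \<alpha>) ?v - Poly_Mapping.single (\<gamma> + \<beta>) ?v"
        using \<alpha> by (simp add: b bracket_add_right bracket_single phi_simps algebra_simps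
            flip: single_uminus single_diff single_add)
      also have "\<dots> \<in> I"
        unfolding I_def by (rule W.span_base) (auto simp: B_def)
      finally show ?case
        using add by (auto simp: bracket_add_left intro: W.subspace_add[OF sub])
    qed
  qed
  have "wbr x y \<in> I" if "y \<in> I" for x y
    using that unfolding I_def
  proof (induction rule: W.span_induct_alt)
    case base
    then show ?case by (simp add: W.span_zero)
  next
    case (step c b y)
    then show ?case
      using ideal1[of b x] unfolding I_def
      by (simp add: bracket_add_right bracket_scale_right W.span_add W.span_scale)
  qed
  with sub have "lie_ideal wscale wbr I" by (simp add: lie_ideal_def)
  then consider "I = {0}" | "I = UNIV" using simple by (auto simp: simple_lie_algebra_def)
  then show ?thesis
  proof cases
    case 1
    have "Poly_Mapping.single (0 + \<alpha>) d - Poly_Mapping.single 0 d \<in> I"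
      unfolding I_def B_def by (rule W.span_base) blast
    with 1 have "Poly_Mapping.single \<alpha> d = Poly_Mapping.single 0 d" by simp
    then have "Poly_Mapping.lookup (Poly_Mapping.single 0 d) \<alpha> = d" by (metis lookup_single_eq)
    with d show ?thesis by (auto simp: lookup_single when_def split: if_splits)
  next
    case 2
    define s where "s x = (\<Sum>\<beta>\<in>Poly_Mapping.keys x. Poly_Mapping.lookup x \<beta>)" for x :: "'a \<Rightarrow>\<^sub>0 't"
    have s_super: "s x = (\<Sum>\<beta>\<in>S. Poly_Mapping.lookup x \<beta>)"
      if "finite S" "Poly_Mapping.keys x \<subseteq> S" for x S
      unfolding s_def by (rule sum.mono_neutral_left) (use that in \<open>auto simp: in_keys_iff\<close>)
    have s_add: "s (x + y) = s x + s y" for x y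
      by (subst (1 2 3) s_super[of "Poly_Mapping.keys x \<union> Poly_Mapping.keys y"])
        (use keys_add[of x y] in \<open>auto simp: lookup_add sum.distrib\<close>)
    have s_single: "s (Poly_Mapping.single \<beta> e) = e" for \<beta> e
      by (subst s_super[of "{\<beta>}"]) auto
    have s_scale: "s (wscale c x) = scale c (s x)" for c x
      by (subst (1 2) s_super[of "Poly_Mapping.keys x"])
        (auto simp: in_keys_iff scale_sum_right)
    have "s y = 0" if "y \<in> I" for y
      using that unfolding I_def
    proof (induction rule: W.span_induct_alt)
      case base
      then show ?case by (simp add: s_def)
    next
      case (step c b y)
      then obtain \<beta> e where "b = Poly_Mapping.single (\<beta> + \<alpha>) e + Poly_Mapping.single \<beta> (- e)"
        unfolding B_def by (auto simp: single_uminus)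
      with step show ?case by (simp add: s_add s_scale s_single)
    qed
    from this[of "Poly_Mapping.single 0 d"] 2 d show ?thesis by (simp add: s_single)
  qed
qed

end

locale nondegenerate_witt_datum = witt_datum scale \<phi>
  for scale :: "'f::field_char_0 \<Rightarrow> 't::ab_group_add \<Rightarrow> 't"
  and \<phi> :: "'t \<Rightarrow> 'a::ab_group_add \<Rightarrow> 'f" +
  assumes nondegenerate_left: "(\<And>\<alpha>. \<phi> d \<alpha> = 0) \<Longrightarrow> d = 0"
    and nondegenerate_right: "(\<And>d. \<phi> d \<alpha> = 0) \<Longrightarrow> \<alpha> = 0"
    and nontrivial: "\<exists>d::'t. d \<noteq> 0"
begin

lemma eq_left: "(\<And>\<alpha>. \<phi> d \<alpha> = \<phi> e \<alpha>) \<Longrightarrow> d = e"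
  using nondegenerate_left[of "d - e"] by (simp add: phi_simps)

lemma eq_right: "(\<And>d. \<phi> d \<alpha> = \<phi> d \<beta>) \<Longrightarrow> \<alpha> = \<beta>"
  using nondegenerate_right[of "\<alpha> - \<beta>"] by (simp add: phi_simps)

lemma torsion_free: "n > 0 \<Longrightarrow> nat_multiple n \<alpha> = 0 \<Longrightarrow> (\<alpha>::'a) = 0"
  by (rule nondegenerate_right) (metis phi_nat_multiple phi_0_right mult_eq_0_iff of_nat_eq_0_iff neq0_conv)

lemma obtain_pairing_one:
  assumes "\<alpha> \<noteq> 0"
  obtains e where "\<phi> e \<alpha> = 1"
proof -
  obtain d where "\<phi> d \<alpha> \<noteq> 0" using nondegenerate_right assms by blast
  then have "\<phi> (scale (inverse (\<phi> d \<alpha>)) d) \<alpha> = 1" by (simp add: phi_simps)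
  then show thesis by (rule that)
qed

text \<open>Torus elements vanishing on a nonzero degree form a proper subspace, and over an infinite
  field finitely many proper subspaces do not cover \<open>T\<close>.\<close>

lemma generic_nonzero:
  assumes "finite Z" "0 \<notin> Z"
  shows "\<exists>d. \<forall>\<alpha>\<in>Z. \<phi> d \<alpha> \<noteq> 0"
  using assms
proof (induction Z)
  case (insert \<alpha> Z)
  then obtain d where d: "\<And>\<beta>. \<beta> \<in> Z \<Longrightarrow> \<phi> d \<beta> \<noteq> 0" by auto
  obtain e where e: "\<phi> e \<alpha> = 1" using insert.prems by (auto intro: obtain_pairing_one)
  let ?bad = "insert (- \<phi> d \<alpha>) ((\<lambda>\<beta>. - \<phi> d \<beta> / \<phi> e \<beta>) ` Z)"
  have "finite ?bad" using insert by simp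
  then obtain c where c: "c \<notin> ?bad" using ex_new_if_finite[OF infinite_UNIV_char_0] by blast
  have "\<phi> (d + scale c e) \<beta> \<noteq> 0" if "\<beta> \<in> insert \<alpha> Z" for \<beta>
  proof (cases "\<phi> e \<beta> = 0")
    case True
    with that d e show ?thesis by (auto simp: phi_simps)
  next
    case False
    then have "c \<noteq> - \<phi> d \<beta> / \<phi> e \<beta>" using c that e by auto
    with False show ?thesis by (auto simp: phi_simps field_simps add_eq_0_iff)
  qed
  then show ?case by blast
qed auto

lemma generic_injective:
  assumes "finite Z"
  obtains d where "inj_on (\<phi> d) Z"
proof -
  let ?D = "(\<lambda>(\<alpha>, \<beta>). \<alpha> - \<beta>) ` (Z \<times> Z) - {0}"
  obtain d where "\<forall>\<alpha>\<in>?D. \<phi> d \<alpha> \<noteq> 0" using generic_nonzero[of ?D] assms by auto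
  then have "inj_on (\<phi> d) Z"
    by (intro inj_onI) (force simp: phi_simps)
  then show thesis by (rule that)
qed

end

lemma simple_imp_nondegenerate_witt_datum:
  fixes scale :: "'f::field_char_0 \<Rightarrow> 't::ab_group_add \<Rightarrow> 't"
    and \<phi> :: "'t \<Rightarrow> 'a::ab_group_add \<Rightarrow> 'f"
  assumes "witt_datum scale \<phi>"
    and simple: "simple_lie_algebra (witt_scale scale :: 'f \<Rightarrow> ('a \<Rightarrow>\<^sub>0 't) \<Rightarrow> _) (witt_bracket scale \<phi>)"
  shows "nondegenerate_witt_datum scale \<phi>"
proof -
  interpret witt_datum scale \<phi> by fact
  obtain x y where "wbr x y \<noteq> 0" using simple by (auto simp: simple_lie_algebra_def)
  then have "x \<noteq> 0" by auto
  then obtain \<alpha> where "Poly_Mapping.lookup x \<alpha> \<noteq> 0" by (metis poly_mapping_eqI lookup_zero)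
  then have "\<exists>d::'t. d \<noteq> 0" by blast
  with simple_imp_nondegenerate_left[OF simple] simple_imp_nondegenerate_right[OF simple]
  show ?thesis by unfold_locales blast+
qed

section \<open>Torsion-free abelian groups are orderable\<close>

text \<open>A total group order, given by its cone of nonnegative elements.\<close>

definition total_cone :: "'a::ab_group_add set \<Rightarrow> bool" where
  "total_cone P \<longleftrightarrow> 0 \<in> P \<and> (\<forall>a\<in>P. \<forall>b\<in>P. a + b \<in> P) \<and>
    (\<forall>a\<in>P. - a \<in> P \<longrightarrow> a = 0) \<and> (\<forall>a. a \<in> P \<or> - a \<in> P)"

lemma total_cone_uminus: "total_cone P \<Longrightarrow> total_cone (uminus ` P)"
proof -
  assume P: "total_cone P"
  have "uminus ` P = {a. - a \<in> P}" by (auto simp: image_iff) (metis add.inverse_inverse)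
  with P show ?thesis unfolding total_cone_def
    by (metis (no_types, lifting) add.commute add.inverse_inverse mem_Collect_eq minus_add_distrib minus_zero neg_equal_0_iff_equal)
qed

text \<open>A maximal cone is total: if neither \<open>g\<close> nor \<open>- g\<close> could be adjoined to it, then positive
  multiples of both would lie in its negative, and torsion-freeness gives \<open>g = 0\<close>.\<close>

lemma torsion_free_total_cone:
  assumes tf: "\<And>n (a::'a::ab_group_add). n > 0 \<Longrightarrow> nat_multiple n a = 0 \<Longrightarrow> a = 0"
  shows "\<exists>P::'a set. total_cone P"
proof -
  define \<C> where "\<C> = {P::'a set. (\<forall>a\<in>P. \<forall>b\<in>P. a + b \<in> P) \<and> (\<forall>a\<in>P. - a \<in> P \<longrightarrow> a = 0)}"
  have "\<exists>M\<in>\<C>. \<forall>X\<in>\<C>. M \<subseteq> X \<longrightarrow> X = M"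
  proof (rule subset_Zorn')
    fix C assume C: "subset.chain \<C> C"
    then have ch: "X \<subseteq> Y \<or> Y \<subseteq> X" if "X \<in> C" "Y \<in> C" for X Y
      using that by (auto simp: subset.chain_def)
    have sub: "X \<in> \<C>" if "X \<in> C" for X using that C by (auto simp: subset.chain_def)
    have both: "\<exists>Z\<in>C. a \<in> Z \<and> b \<in> Z" if "a \<in> \<Union> C" "b \<in> \<Union> C" for a b
      using that ch by blast
    have "a + b \<in> \<Union> C" if ab: "a \<in> \<Union> C" "b \<in> \<Union> C" for a b
      using both[OF ab] sub unfolding \<C>_def by blast
    moreover have "a = 0" if ab: "a \<in> \<Union> C" "- a \<in> \<Union> C" for a
      using both[OF ab] sub unfolding \<C>_def by blast
    ultimately show "\<Union> C \<in> \<C>" unfolding \<C>_def by blast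
  qed
  then obtain M where M: "M \<in> \<C>" and maximal: "\<And>X. X \<in> \<C> \<Longrightarrow> M \<subseteq> X \<Longrightarrow> X = M" by blast
  have add: "\<And>a b. a \<in> M \<Longrightarrow> b \<in> M \<Longrightarrow> a + b \<in> M" and pointed: "\<And>a. a \<in> M \<Longrightarrow> - a \<in> M \<Longrightarrow> a = 0"
    using M by (auto simp: \<C>_def)
  have "insert 0 M \<in> \<C>" using add pointed by (auto simp: \<C>_def)
  from maximal[OF this] have zero: "0 \<in> M" by auto
  have adjoin: "g \<in> M \<or> (\<exists>k>0. - nat_multiple k g \<in> M)" for g
  proof (rule ccontr)
    assume *: "\<not> (g \<in> M \<or> (\<exists>k>0. - nat_multiple k g \<in> M))"
    define N where "N = {p + nat_multiple n g | p n. p \<in> M}"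
    have "N \<in> \<C>"
      unfolding \<C>_def
    proof (intro CollectI conjI ballI impI)
      fix a b assume "a \<in> N" "b \<in> N"
      then obtain p n q m where *: "p \<in> M" "q \<in> M" "a = p + nat_multiple n g" "b = q + nat_multiple m g"
        by (auto simp: N_def)
      then have "a + b = (p + q) + nat_multiple (n + m) g" by (simp add: nat_multiple_add)
      with * add show "a + b \<in> N" unfolding N_def by blast
    next
      fix a assume "a \<in> N" "- a \<in> N"
      then obtain p n q m where pq: "p \<in> M" "q \<in> M" "a = p + nat_multiple n g" "- a = q + nat_multiple m g"
        by (auto simp: N_def)
      then have "(p + q) + nat_multiple (n + m) g = a + (- a)"
        by (simp add: nat_multiple_add)
      then have "p + q = - nat_multiple (n + m) g" by (simp add: eq_neg_iff_add_eq_0)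
      then have "n + m = 0" using * add[OF pq(1,2)] by (metis neq0_conv)
      with pq have "a \<in> M" "- a \<in> M" by auto
      then show "a = 0" by (rule pointed)
    qed
    moreover have "M \<subseteq> N"
    proof
      fix p assume "p \<in> M"
      then have "p = p + nat_multiple 0 g \<and> p \<in> M" by simp
      then show "p \<in> N" unfolding N_def by blast
    qed
    moreover have "g \<in> N"
    proof -
      have "g = 0 + nat_multiple 1 g" by simp
      with zero show ?thesis unfolding N_def by blast
    qed
    ultimately show False using maximal * by blast
  qed
  have "g \<in> M \<or> - g \<in> M" for g
  proof (rule ccontr)
    assume *: "\<not> (g \<in> M \<or> - g \<in> M)"
    obtain k l where kl: "k > 0" "l > 0" "- nat_multiple k g \<in> M" "- nat_multiple l (- g) \<in> M"
      using * adjoin[of g] adjoin[of "- g"] by blast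
    then have "nat_multiple l g \<in> M" by (simp add: nat_multiple_uminus)
    then have "nat_multiple (k * l) g \<in> M"
      using nat_multiple_mem[OF zero add] by (auto simp: nat_multiple_mult)
    moreover have "- nat_multiple (k * l) g \<in> M"
      using nat_multiple_mem[OF zero add kl(3), of l]
      by (simp add: nat_multiple_uminus mult.commute[of k l] nat_multiple_mult)
    ultimately have "nat_multiple (k * l) g = 0" by (rule pointed)
    then have "g = 0" using tf[of "k * l" g] kl by simp
    with * zero show False by simp
  qed
  with zero add pointed have "total_cone M" by (auto simp: total_cone_def)
  then show ?thesis ..
qed

lemma total_cone_Max:
  assumes P: "total_cone P" and "finite S" "S \<noteq> {}"
  shows "\<exists>m\<in>S. \<forall>s\<in>S. m - s \<in> P"
  using assms(2,3)
proof (induction S rule: finite_ne_induct)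
  case (singleton a)
  then show ?case using P by (simp add: total_cone_def)
next
  case (insert a S)
  then obtain m where m: "m \<in> S" "\<And>s. s \<in> S \<Longrightarrow> m - s \<in> P" by blast
  have "a - m \<in> P \<or> m - a \<in> P" using P unfolding total_cone_def by (metis minus_diff_eq)
  then show ?case
  proof
    assume am: "a - m \<in> P"
    have "a - s \<in> P" if "s \<in> S" for s
    proof -
      have "a - s = (a - m) + (m - s)" by simp
      with P am m that show ?thesis unfolding total_cone_def by metis
    qed
    then show ?case using P by (auto simp: total_cone_def)
  next
    assume "m - a \<in> P"
    then show ?case using m by auto
  qed
qed

section \<open>Locally ad-finite elements\<close>

context nondegenerate_witt_datum
begin

lemma lookup_bracket_torus:
  "Poly_Mapping.lookup (wbr (Poly_Mapping.single 0 d) x) \<alpha> = scale (\<phi> d \<alpha>) (Poly_Mapping.lookup x \<alpha>)"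
proof (induction x rule: poly_mapping_add_induct)
  case (add \<beta> e x)
  then show ?case
    by (simp add: bracket_add_right bracket_single lookup_add lookup_single when_def phi_simps
        scale_right_distrib)
qed simp

lemma keys_bracket:
  assumes "s \<in> Poly_Mapping.keys (wbr x y)"
  shows "\<exists>a\<in>Poly_Mapping.keys x. \<exists>b\<in>Poly_Mapping.keys y. s = a + b"
proof (rule ccontr)
  assume *: "\<not> ?thesis"
  have "Poly_Mapping.lookup (wbr x y) s = 0"
    unfolding witt_bracket_def lookup_sum
    by (intro sum.neutral ballI) (use * in \<open>auto simp: lookup_single when_def\<close>)
  with assms show False by (simp add: in_keys_iff)
qed

text \<open>Only the two leading terms can contribute to the highest degree of a bracket.\<close>

lemma bracket_top:
  assumes P: "total_cone P"
    and x: "\<And>s. s \<in> Poly_Mapping.keys x \<Longrightarrow> \<gamma> - s \<in> P"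
    and y: "\<And>s. s \<in> Poly_Mapping.keys y \<Longrightarrow> \<beta> - s \<in> P"
  shows "Poly_Mapping.lookup (wbr x y) (\<gamma> + \<beta>)
      = scale (\<phi> (Poly_Mapping.lookup x \<gamma>) \<beta>) (Poly_Mapping.lookup y \<beta>)
        - scale (\<phi> (Poly_Mapping.lookup y \<beta>) \<gamma>) (Poly_Mapping.lookup x \<gamma>)" (is "_ = ?v")
    and "s \<in> Poly_Mapping.keys (wbr x y) \<Longrightarrow> \<gamma> + \<beta> - s \<in> P"
proof -
  let ?S = "insert \<gamma> (Poly_Mapping.keys x)" and ?S' = "insert \<beta> (Poly_Mapping.keys y)"
  let ?f = "\<lambda>\<alpha> \<beta>'. Poly_Mapping.single (\<alpha> + \<beta>')
        (scale (\<phi> (Poly_Mapping.lookup x \<alpha>) \<beta>') (Poly_Mapping.lookup y \<beta>')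
         - scale (\<phi> (Poly_Mapping.lookup y \<beta>') \<alpha>) (Poly_Mapping.lookup x \<alpha>))"
  have 0: "0 \<in> P" using P by (simp add: total_cone_def)
  have eq: "\<alpha> = \<gamma> \<and> \<beta>' = \<beta>" if "\<alpha> \<in> ?S" "\<beta>' \<in> ?S'" "\<alpha> + \<beta>' = \<gamma> + \<beta>" for \<alpha> \<beta>'
  proof -
    have "\<gamma> - \<alpha> \<in> P" "\<beta> - \<beta>' \<in> P" using that x y 0 by auto
    moreover have "\<beta> - \<beta>' = - (\<gamma> - \<alpha>)" using that(3) by (simp add: algebra_simps)
    ultimately have "\<gamma> - \<alpha> = 0" using P unfolding total_cone_def by metis
    then show ?thesis using that by auto
  qed
  have "Poly_Mapping.lookup (wbr x y) (\<gamma> + \<beta>)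
      = (\<Sum>\<alpha>\<in>?S. \<Sum>\<beta>'\<in>?S'. Poly_Mapping.lookup (?f \<alpha> \<beta>') (\<gamma> + \<beta>))"
    by (subst witt_bracket_superset[of ?S ?S']) (auto simp only: lookup_sum finite_insert finite_keys)
  also have "\<dots> = (\<Sum>\<alpha>\<in>?S. \<Sum>\<beta>'\<in>?S'. if \<beta>' = \<beta> then (if \<alpha> = \<gamma> then ?v else 0) else 0)"
  proof (intro sum.cong refl)
    fix \<alpha> \<beta>' assume S: "\<alpha> \<in> ?S" "\<beta>' \<in> ?S'"
    show "Poly_Mapping.lookup (?f \<alpha> \<beta>') (\<gamma> + \<beta>) = (if \<beta>' = \<beta> then (if \<alpha> = \<gamma> then ?v else 0) else 0)"
    proof (cases "\<alpha> + \<beta>' = \<gamma> + \<beta>")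
      case True
      with eq S show ?thesis by (metis lookup_single_eq)
    next
      case False
      then have "\<not> (\<alpha> = \<gamma> \<and> \<beta>' = \<beta>)" by blast
      with False show ?thesis by (auto simp only: lookup_single_not_eq if_False if_True split: if_split)
    qed
  qed
  also have "\<dots> = ?v"
    by (simp only: sum.delta finite_insert finite_keys insertI1 if_True)
  finally show "Poly_Mapping.lookup (wbr x y) (\<gamma> + \<beta>) = ?v" .
  assume "s \<in> Poly_Mapping.keys (wbr x y)"
  then obtain a b where ab: "a \<in> Poly_Mapping.keys x" "b \<in> Poly_Mapping.keys y" "s = a + b"
    using keys_bracket by blast
  then have "\<gamma> + \<beta> - s = (\<gamma> - a) + (\<beta> - b)" by simp
  also have "\<dots> \<in> P" using P x[OF ab(1)] y[OF ab(2)] unfolding total_cone_def by blast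
  finally show "\<gamma> + \<beta> - s \<in> P" .
qed

text \<open>The leading coefficient stays on the line through \<open>u\<close> because
  \<open>\<phi>(u, \<beta> + n\<gamma>) u - \<phi>(u, \<gamma>) u = (\<phi>(u, \<beta>) + (n - 1) \<phi>(u, \<gamma>)) u\<close>.\<close>

lemma bracket_iterates_top:
  fixes \<beta> \<gamma> :: 'a
  assumes P: "total_cone P"
    and x: "\<And>s. s \<in> Poly_Mapping.keys x \<Longrightarrow> \<gamma> - s \<in> P"
    and u: "u = Poly_Mapping.lookup x \<gamma>"
    and nz: "\<And>n. \<phi> u \<beta> + (of_nat n - 1) * \<phi> u \<gamma> \<noteq> 0"
  defines "y \<equiv> \<lambda>n. (wbr x ^^ n) (Poly_Mapping.single \<beta> u)"
  shows "(\<forall>s\<in>Poly_Mapping.keys (y n). nat_multiple n \<gamma> + \<beta> - s \<in> P) \<and>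
    (\<exists>k. k \<noteq> 0 \<and> Poly_Mapping.lookup (y n) (nat_multiple n \<gamma> + \<beta>) = scale k u)"
proof (induction n)
  case 0
  have "0 \<in> P" using P by (simp add: total_cone_def)
  then show ?case
    by (intro conjI ballI exI[of _ 1]) (auto simp: y_def split: if_splits)
next
  case (Suc n)
  let ?\<beta> = "nat_multiple n \<gamma> + \<beta>"
  obtain k where k: "k \<noteq> 0" "Poly_Mapping.lookup (y n) ?\<beta> = scale k u" using Suc by blast
  have y: "s \<in> Poly_Mapping.keys (y n) \<Longrightarrow> ?\<beta> - s \<in> P" for s using Suc by blast
  have ySuc: "y (Suc n) = wbr x (y n)" by (simp add: y_def)
  have deg: "nat_multiple (Suc n) \<gamma> + \<beta> = \<gamma> + ?\<beta>" by (simp add: add.assoc)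
  have "Poly_Mapping.lookup (y (Suc n)) (\<gamma> + ?\<beta>)
      = scale (\<phi> u ?\<beta>) (scale k u) - scale (\<phi> (scale k u) \<gamma>) u"
    unfolding ySuc by (simp only: bracket_top(1)[where y = "y n", OF P x y] k(2) flip: u)
  also have "\<dots> = scale (\<phi> u ?\<beta> * k - k * \<phi> u \<gamma>) u"
    by (simp add: phi_scale scale_left_diff_distrib)
  also have "\<phi> u ?\<beta> * k - k * \<phi> u \<gamma> = k * (\<phi> u \<beta> + (of_nat n - 1) * \<phi> u \<gamma>)"
    by (simp add: phi_simps algebra_simps)
  finally have "Poly_Mapping.lookup (y (Suc n)) (\<gamma> + ?\<beta>)
      = scale (k * (\<phi> u \<beta> + (of_nat n - 1) * \<phi> u \<gamma>)) u" .
  moreover have "k * (\<phi> u \<beta> + (of_nat n - 1) * \<phi> u \<gamma>) \<noteq> 0" using k nz by simp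
  moreover have "\<gamma> + ?\<beta> - s \<in> P" if "s \<in> Poly_Mapping.keys (y (Suc n))" for s
    using bracket_top(2)[where y = "y n", OF P x y] that unfolding ySuc by blast
  ultimately show ?case
    unfolding deg by (intro conjI ballI exI[of _ "k * (\<phi> u \<beta> + (of_nat n - 1) * \<phi> u \<gamma>)"])
qed

definition locally_ad_finite :: "('a \<Rightarrow>\<^sub>0 't) \<Rightarrow> bool" where
  "locally_ad_finite x \<longleftrightarrow> (\<forall>y. \<exists>F. finite F \<and> (\<forall>n. Poly_Mapping.keys ((wbr x ^^ n) y) \<subseteq> F))"

text \<open>Otherwise the iterates of \<open>ad x\<close> on \<open>t\<^sup>\<beta> u\<close>, with \<open>u\<close> the leading coefficient of \<open>x\<close>, reach all
  degrees \<open>\<beta> + n\<gamma>\<close>.\<close>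

lemma locally_ad_finite_top_eq_0:
  assumes P: "total_cone P" and fin: "locally_ad_finite x"
    and x: "\<gamma> \<in> Poly_Mapping.keys x" "\<And>s. s \<in> Poly_Mapping.keys x \<Longrightarrow> \<gamma> - s \<in> P"
  shows "\<gamma> = 0"
proof (rule ccontr)
  assume \<gamma>: "\<gamma> \<noteq> 0"
  define u where "u = Poly_Mapping.lookup x \<gamma>"
  have u: "u \<noteq> 0" using x by (simp add: u_def in_keys_iff)
  have "\<exists>\<beta>. \<forall>n. \<phi> u \<beta> + (of_nat n - 1) * \<phi> u \<gamma> \<noteq> 0"
  proof (cases "\<phi> u \<gamma> = 0")
    case True
    then show ?thesis using nondegenerate_left[of u] u by auto
  next
    case False
    (* For beta = 2 gamma the n-th factor is (n + 1) phi(u, gamma); beta = gamma would fail at n = 0. *)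
    have "\<phi> u (nat_multiple 2 \<gamma>) + (of_nat n - 1) * \<phi> u \<gamma> = of_nat (Suc n) * \<phi> u \<gamma>" for n
      by (simp add: phi_simps algebra_simps)
    then show ?thesis using False by (metis mult_eq_0_iff of_nat_eq_0_iff nat.simps(3))
  qed
  then obtain \<beta> where \<beta>: "\<And>n. \<phi> u \<beta> + (of_nat n - 1) * \<phi> u \<gamma> \<noteq> 0" by blast
  obtain F where F: "finite F" "\<And>n. Poly_Mapping.keys ((wbr x ^^ n) (Poly_Mapping.single \<beta> u)) \<subseteq> F"
    using fin unfolding locally_ad_finite_def by blast
  have "nat_multiple n \<gamma> + \<beta> \<in> F" for n
    using bracket_iterates_top[OF P x(2) u_def \<beta>, of n] F(2)[of n] u
    by (auto simp: in_keys_iff)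
  then have "range (\<lambda>n. nat_multiple n \<gamma> + \<beta>) \<subseteq> F" by blast
  moreover have "inj (\<lambda>n. nat_multiple n \<gamma> + \<beta>)"
  proof -
    obtain e where "\<phi> e \<gamma> = 1" using \<gamma> by (rule obtain_pairing_one)
    then have "\<phi> e (nat_multiple n \<gamma>) = of_nat n" for n by (simp add: phi_simps)
    then show ?thesis by (intro injI) (metis add_right_cancel of_nat_eq_iff)
  qed
  ultimately show False using F(1) by (meson finite_subset finite_imageD infinite_UNIV_nat)
qed

text \<open>The highest degree of \<open>x\<close> is \<open>0\<close> both for an order of \<open>A\<close> and for the reversed order.\<close>

lemma locally_ad_finite_imp_torus:
  assumes "locally_ad_finite x"
  shows "Poly_Mapping.keys x \<subseteq> {0}"
proof
  fix s assume s: "s \<in> Poly_Mapping.keys x"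
  obtain P :: "'a set" where P: "total_cone P" using torsion_free_total_cone torsion_free by blast
  have top: "- s \<in> Q" if Q: "total_cone Q" for Q
  proof -
    have "Poly_Mapping.keys x \<noteq> {}" using s by blast
    from total_cone_Max[OF Q finite_keys this]
    obtain \<gamma> where \<gamma>: "\<gamma> \<in> Poly_Mapping.keys x" "\<And>s. s \<in> Poly_Mapping.keys x \<Longrightarrow> \<gamma> - s \<in> Q"
      by blast
    then have "\<gamma> = 0" by (rule locally_ad_finite_top_eq_0[OF Q assms])
    with \<gamma>(2)[OF s] show ?thesis by simp
  qed
  from top[OF P] top[OF total_cone_uminus[OF P]] P show "s \<in> {0}"
    unfolding total_cone_def by auto
qed

section \<open>Automorphisms permute the weight spaces\<close>

lemma automorphism_simps:
  assumes "lie_automorphism wscale wbr \<theta>"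
  shows "\<theta> (x + y) = \<theta> x + \<theta> y" "\<theta> (wscale c x) = wscale c (\<theta> x)"
    "\<theta> (wbr x y) = wbr (\<theta> x) (\<theta> y)" "\<theta> 0 = 0" "\<theta> (x - y) = \<theta> x - \<theta> y"
    "\<theta> x = \<theta> y \<longleftrightarrow> x = y"
proof -
  have 1: "\<theta> (x + y) = \<theta> x + \<theta> y" for x y
    using assms by (auto simp: lie_automorphism_def Vector_Spaces.linear_iff)
  show "\<theta> (x + y) = \<theta> x + \<theta> y" by (rule 1)
  show 0: "\<theta> 0 = 0" using 1[of 0 0] by simp
  show "\<theta> (x - y) = \<theta> x - \<theta> y" using 1[of "x - y" y] by simp
  show "\<theta> (wscale c x) = wscale c (\<theta> x)" "\<theta> (wbr x y) = wbr (\<theta> x) (\<theta> y)"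
    "\<theta> x = \<theta> y \<longleftrightarrow> x = y"
    using assms by (auto simp: lie_automorphism_def Vector_Spaces.linear_iff bij_def inj_eq)
qed

lemma automorphism_inv:
  assumes \<theta>: "lie_automorphism wscale wbr \<theta>"
  shows "lie_automorphism wscale wbr (inv \<theta>)"
proof -
  have bij: "bij \<theta>" using \<theta> by (simp add: lie_automorphism_def)
  then have \<theta>_inv: "\<theta> (inv \<theta> x) = x" for x by (simp add: bij_is_surj surj_f_inv_f)
  have eqI: "inv \<theta> x = y" if "\<theta> y = x" for x y
    using that bij by (simp add: bij_is_inj inv_f_eq)
  show ?thesis
    unfolding lie_automorphism_def Vector_Spaces.linear_iff
    by (intro conjI allI vector_space_witt_scale bij_imp_bij_inv bij eqI)
      (simp_all add: automorphism_simps[OF \<theta>] \<theta>_inv)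
qed

lemma automorphism_iterate:
  assumes \<theta>: "lie_automorphism wscale wbr \<theta>"
  shows "(wbr (\<theta> x) ^^ n) (\<theta> y) = \<theta> ((wbr x ^^ n) y)"
  by (induction n) (simp_all add: automorphism_simps[OF \<theta>])

text \<open>The elements of the torus \<open>T = t\<^sup>0T\<close> act diagonally, so their images under an automorphism are
  locally ad-finite.\<close>

lemma automorphism_torus_locally_ad_finite:
  assumes \<theta>: "lie_automorphism wscale wbr \<theta>"
  shows "locally_ad_finite (\<theta> (Poly_Mapping.single 0 d))"
  unfolding locally_ad_finite_def
proof
  fix y
  let ?h = "Poly_Mapping.single 0 d"
  obtain z where y: "y = \<theta> z" using \<theta> by (metis bij_pointE lie_automorphism_def)
  show "\<exists>F. finite F \<and> (\<forall>n. Poly_Mapping.keys ((wbr (\<theta> ?h) ^^ n) y) \<subseteq> F)"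
    unfolding y automorphism_iterate[OF \<theta>]
  proof (induction z rule: poly_mapping_add_induct)
    case zero
    have "(wbr ?h ^^ n) 0 = 0" for n by (induction n) auto
    then show ?case by (auto simp: automorphism_simps[OF \<theta>])
  next
    case (add \<alpha> e z)
    then obtain F where F: "finite F" "\<And>n. Poly_Mapping.keys (\<theta> ((wbr ?h ^^ n) z)) \<subseteq> F" by blast
    let ?s = "Poly_Mapping.single \<alpha> e"
    have "(wbr ?h ^^ n) (?s + z) = wscale (\<phi> d \<alpha> ^ n) ?s + (wbr ?h ^^ n) z" for n
      by (induction n)
        (simp_all add: bracket_add_right bracket_scale_right bracket_single phi_simps
          witt_scale_single)
    then have eq: "\<theta> ((wbr ?h ^^ n) (?s + z)) = wscale (\<phi> d \<alpha> ^ n) (\<theta> ?s) + \<theta> ((wbr ?h ^^ n) z)" for n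
      by (simp add: automorphism_simps[OF \<theta>])
    have "Poly_Mapping.keys (wscale c (\<theta> ?s)) \<subseteq> Poly_Mapping.keys (\<theta> ?s)" for c
      by (auto simp: in_keys_iff)
    then have "Poly_Mapping.keys (\<theta> ((wbr ?h ^^ n) (?s + z))) \<subseteq> Poly_Mapping.keys (\<theta> ?s) \<union> F" for n
      unfolding eq using F(2)[of n] keys_add[of "wscale (\<phi> d \<alpha> ^ n) (\<theta> ?s)" "\<theta> ((wbr ?h ^^ n) z)"]
      by blast
    then show ?case using F(1) by (meson finite_Un finite_keys)
  qed
qed

lemma keys_subset_singletonD:
  "Poly_Mapping.keys x \<subseteq> {\<alpha>} \<Longrightarrow> x = Poly_Mapping.single \<alpha> (Poly_Mapping.lookup x \<alpha>)"
  by (rule poly_mapping_eqI) (auto simp: lookup_single when_def in_keys_iff)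

lemma automorphism_torus:
  assumes \<theta>: "lie_automorphism wscale wbr \<theta>"
  shows "\<theta> (Poly_Mapping.single 0 d)
    = Poly_Mapping.single 0 (Poly_Mapping.lookup (\<theta> (Poly_Mapping.single 0 d)) 0)"
  using locally_ad_finite_imp_torus[OF automorphism_torus_locally_ad_finite[OF \<theta>]]
  by (rule keys_subset_singletonD)

lemma automorphism_weight:
  assumes \<theta>: "lie_automorphism wscale wbr \<theta>"
    and d: "\<theta> (Poly_Mapping.single 0 d) = Poly_Mapping.single 0 d'"
    and \<beta>: "\<beta> \<in> Poly_Mapping.keys (\<theta> (Poly_Mapping.single \<alpha> e))"
  shows "\<phi> d' \<beta> = \<phi> d \<alpha>"
proof -
  let ?z = "\<theta> (Poly_Mapping.single \<alpha> e)"
  have "wbr (Poly_Mapping.single 0 d') ?z = \<theta> (wbr (Poly_Mapping.single 0 d) (Poly_Mapping.single \<alpha> e))"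
    by (simp add: automorphism_simps[OF \<theta>] d)
  also have "\<dots> = wscale (\<phi> d \<alpha>) ?z"
    by (simp add: bracket_single phi_simps automorphism_simps[OF \<theta>] flip: witt_scale_single)
  finally have "scale (\<phi> d' \<beta>) (Poly_Mapping.lookup ?z \<beta>) = scale (\<phi> d \<alpha>) (Poly_Mapping.lookup ?z \<beta>)"
    by (metis lookup_bracket_torus lookup_witt_scale)
  with \<beta> show ?thesis by (simp add: in_keys_iff)
qed

lemma automorphism_single_nonzero:
  assumes \<theta>: "lie_automorphism wscale wbr \<theta>" and "d \<noteq> 0"
  shows "\<exists>\<beta>. \<beta> \<in> Poly_Mapping.keys (\<theta> (Poly_Mapping.single \<alpha> d))"
proof -
  have "Poly_Mapping.single \<alpha> d \<noteq> 0" using \<open>d \<noteq> 0\<close> by (metis lookup_single_eq lookup_zero)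
  then have "\<theta> (Poly_Mapping.single \<alpha> d) \<noteq> 0" by (metis automorphism_simps(4,6)[OF \<theta>])
  then show ?thesis by (meson equals0I keys_eq_empty)
qed

text \<open>The homogeneous components \<open>t\<^sup>\<alpha>T\<close> are the weight spaces of the torus, with pairwise distinct
  weights \<open>\<phi>(_, \<alpha>)\<close>. An automorphism preserves the torus, so it permutes them.\<close>

lemma automorphism_weight_spaces:
  assumes \<theta>: "lie_automorphism wscale wbr \<theta>"
  obtains \<sigma> :: "'a \<Rightarrow> 'a" and \<tau> :: "'t \<Rightarrow> 't"
  where "\<And>\<alpha> d. \<theta> (Poly_Mapping.single \<alpha> d)
      = Poly_Mapping.single (\<sigma> \<alpha>) (Poly_Mapping.lookup (\<theta> (Poly_Mapping.single \<alpha> d)) (\<sigma> \<alpha>))"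
    and "\<And>d. \<theta> (Poly_Mapping.single 0 d) = Poly_Mapping.single 0 (\<tau> d)"
    and "\<And>d \<alpha>. \<phi> (\<tau> d) (\<sigma> \<alpha>) = \<phi> d \<alpha>" "bij \<tau>" "bij \<sigma>" "\<And>\<alpha> \<beta>. \<sigma> (\<alpha> + \<beta>) = \<sigma> \<alpha> + \<sigma> \<beta>"
proof -
  note inv = automorphism_inv[OF \<theta>]
  have bij: "bij \<theta>" using \<theta> by (simp add: lie_automorphism_def)
  define \<tau> where "\<tau> d = Poly_Mapping.lookup (\<theta> (Poly_Mapping.single 0 d)) 0" for d
  have \<tau>: "\<theta> (Poly_Mapping.single 0 d) = Poly_Mapping.single 0 (\<tau> d)" for d
    unfolding \<tau>_def by (rule automorphism_torus[OF \<theta>])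
  have "surj \<tau>"
  proof (rule surjI)
    fix e
    let ?d = "Poly_Mapping.lookup (inv \<theta> (Poly_Mapping.single 0 e)) 0"
    have "inv \<theta> (Poly_Mapping.single 0 e) = Poly_Mapping.single 0 ?d"
      by (rule automorphism_torus[OF inv])
    then have "\<theta> (Poly_Mapping.single 0 ?d) = Poly_Mapping.single 0 e"
      using bij by (metis bij_is_surj surj_f_inv_f)
    then show "\<tau> ?d = e" by (simp add: \<tau>_def)
  qed
  obtain d0 :: 't where d0: "d0 \<noteq> 0" using nontrivial by blast
  define \<sigma> where "\<sigma> \<alpha> = (SOME \<beta>. \<beta> \<in> Poly_Mapping.keys (\<theta> (Poly_Mapping.single \<alpha> d0)))" for \<alpha>
  have \<sigma>: "\<phi> (\<tau> d) (\<sigma> \<alpha>) = \<phi> d \<alpha>" for d \<alpha>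
  proof -
    have "\<exists>\<beta>. \<beta> \<in> Poly_Mapping.keys (\<theta> (Poly_Mapping.single \<alpha> d0))"
      by (rule automorphism_single_nonzero[OF \<theta> d0])
    then have "\<sigma> \<alpha> \<in> Poly_Mapping.keys (\<theta> (Poly_Mapping.single \<alpha> d0))"
      unfolding \<sigma>_def by (rule someI_ex)
    then show ?thesis by (rule automorphism_weight[OF \<theta> \<tau>])
  qed
  have \<tau>_eq: "\<alpha> = \<beta>" if "\<And>d. \<phi> (\<tau> d) \<alpha> = \<phi> (\<tau> d) \<beta>" for \<alpha> \<beta>
    by (rule eq_right) (metis \<open>surj \<tau>\<close> surjD that)
  have single: "\<theta> (Poly_Mapping.single \<alpha> d)
      = Poly_Mapping.single (\<sigma> \<alpha>) (Poly_Mapping.lookup (\<theta> (Poly_Mapping.single \<alpha> d)) (\<sigma> \<alpha>))" for \<alpha> d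
  proof (rule keys_subset_singletonD, rule subsetI)
    fix \<beta> assume "\<beta> \<in> Poly_Mapping.keys (\<theta> (Poly_Mapping.single \<alpha> d))"
    then have "\<beta> = \<sigma> \<alpha>" by (intro \<tau>_eq) (simp add: automorphism_weight[OF \<theta> \<tau>] \<sigma>)
    then show "\<beta> \<in> {\<sigma> \<alpha>}" by simp
  qed
  have "inj \<tau>" by (rule injI) (metis \<sigma> eq_left)
  have add: "\<sigma> (\<alpha> + \<beta>) = \<sigma> \<alpha> + \<sigma> \<beta>" for \<alpha> \<beta> by (rule \<tau>_eq) (simp add: phi_simps \<sigma>)
  have "inj \<sigma>" by (rule injI) (metis \<sigma> eq_right)
  moreover have "surj \<sigma>"
  proof -
    have "\<exists>\<alpha>. \<beta> = \<sigma> \<alpha>" for \<beta>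
    proof -
      obtain \<alpha> where \<alpha>: "\<alpha> \<in> Poly_Mapping.keys (inv \<theta> (Poly_Mapping.single \<beta> d0))"
        using automorphism_single_nonzero[OF inv d0] by blast
      have "inv \<theta> (Poly_Mapping.single 0 (\<tau> d)) = Poly_Mapping.single 0 d" for d
        using bij by (simp add: bij_is_inj inv_f_eq \<tau>)
      then have "\<phi> d \<alpha> = \<phi> (\<tau> d) \<beta>" for d
        using automorphism_weight[OF inv _ \<alpha>] by blast
      then have "\<beta> = \<sigma> \<alpha>" by (intro \<tau>_eq) (simp add: \<sigma>)
      then show ?thesis ..
    qed
    then show ?thesis by blast
  qed
  ultimately have "bij \<sigma>" by (simp add: bij_def)
  have "bij \<tau>" using \<open>inj \<tau>\<close> \<open>surj \<tau>\<close> by (simp add: bij_def)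
  show thesis by (rule that[OF single \<tau> \<sigma> \<open>bij \<tau>\<close> \<open>bij \<sigma>\<close> add])
qed

end

section \<open>Automorphisms are monomial\<close>

text \<open>After composition with the permutation of weight spaces, an automorphism has the form
  \<open>t\<^sup>\<alpha>d \<mapsto> t\<^sup>\<alpha>g\<^sub>\<alpha>(d)\<close>; compatibility with the bracket is the functional equation below.\<close>

locale degree_preserving_twist = nondegenerate_witt_datum scale \<phi>
  for scale :: "'f::field_char_0 \<Rightarrow> 't::ab_group_add \<Rightarrow> 't"
  and \<phi> :: "'t \<Rightarrow> 'a::ab_group_add \<Rightarrow> 'f" +
  fixes g :: "'a \<Rightarrow> 't \<Rightarrow> 't"
  assumes g_add: "g \<alpha> (d + e) = g \<alpha> d + g \<alpha> e"
    and g_scale: "g \<alpha> (scale c d) = scale c (g \<alpha> d)"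
    and g_inj: "g \<alpha> d = 0 \<Longrightarrow> d = 0"
    and g_zero_degree: "g 0 d = d"
    and g_bracket: "g (\<alpha> + \<beta>) (scale (\<phi> d \<beta>) e - scale (\<phi> e \<alpha>) d)
      = scale (\<phi> (g \<alpha> d) \<beta>) (g \<beta> e) - scale (\<phi> (g \<beta> e) \<alpha>) (g \<alpha> d)"
begin

lemma g_0: "g \<alpha> 0 = 0"
  using g_add[of \<alpha> 0 0] by simp

lemma g_uminus: "g \<alpha> (- d) = - g \<alpha> d"
  using g_add[of \<alpha> d "- d"] by (simp add: g_0 eq_neg_iff_add_eq_0 add.commute)

lemma g_diff: "g \<alpha> (d - e) = g \<alpha> d - g \<alpha> e"
  using g_add[of \<alpha> d "- e"] by (simp add: g_uminus)

lemma g_opposite: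
  "scale (\<phi> d \<alpha>) e + scale (\<phi> e \<alpha>) d
    = scale (\<phi> (g \<alpha> d) \<alpha>) (g (- \<alpha>) e) + scale (\<phi> (g (- \<alpha>) e) \<alpha>) (g \<alpha> d)"
proof -
  have "- (scale (\<phi> d \<alpha>) e + scale (\<phi> e \<alpha>) d)
      = - (scale (\<phi> (g \<alpha> d) \<alpha>) (g (- \<alpha>) e) + scale (\<phi> (g (- \<alpha>) e) \<alpha>) (g \<alpha> d))"
    using g_bracket[of \<alpha> "- \<alpha>" d e] by (simp add: g_zero_degree phi_simps)
  then show ?thesis by (simp only: neg_equal_iff_equal)
qed

text \<open>For a vector \<open>k\<close> that pairs to \<open>0\<close> with \<open>\<alpha>\<close>, the relation between \<open>g\<^sub>\<alpha> k\<close> and \<open>g\<^sub>-\<^sub>\<alpha> k\<close> loses its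
  left-hand side. Pairing the rest with \<open>\<alpha>\<close> doubles the product of the two pairings, which hence
  vanishes.\<close>

lemma g_kernel:
  assumes k: "\<phi> k \<alpha> = 0"
  shows "\<phi> (g \<alpha> k) \<alpha> = 0"
proof (rule ccontr)
  assume p: "\<phi> (g \<alpha> k) \<alpha> \<noteq> 0"
  have eq: "scale (\<phi> (g \<alpha> k) \<alpha>) (g (- \<alpha>) k) + scale (\<phi> (g (- \<alpha>) k) \<alpha>) (g \<alpha> k) = 0"
    using g_opposite[of k \<alpha> k] k by (simp del: add_eq_0_iff)
  have "\<phi> (scale (\<phi> (g \<alpha> k) \<alpha>) (g (- \<alpha>) k) + scale (\<phi> (g (- \<alpha>) k) \<alpha>) (g \<alpha> k)) \<alpha> = 0"
    unfolding eq by (rule phi_0)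
  with p have "\<phi> (g (- \<alpha>) k) \<alpha> = 0" by (simp add: phi_simps)
  with eq p have "k = 0" using g_inj by simp
  with p show False by (simp add: g_0 phi_0)
qed

text \<open>The functional equation for \<open>\<alpha>\<close> and \<open>- \<alpha>\<close> makes \<open>g\<^sub>\<alpha>\<close> a scalar on the kernel of
  \<open>\<phi>(_, \<alpha>)\<close>, and the same scalar modulo this kernel on the whole torus.\<close>

lemma g_scaled_transvection:
  assumes "\<alpha> \<noteq> 0"
  shows "\<exists>a b w. a * b = 1 \<and> \<phi> w \<alpha> = 0 \<and>
    (\<forall>d. g \<alpha> d = scale a d + scale (\<phi> d \<alpha>) w) \<and>
    (\<forall>d. g (- \<alpha>) d = scale b d - scale (\<phi> d \<alpha> * b * b) w)"
proof -
  obtain e where e: "\<phi> e \<alpha> = 1" using assms by (rule obtain_pairing_one)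
  define a where "a = \<phi> (g \<alpha> e) \<alpha>"
  define b where "b = \<phi> (g (- \<alpha>) e) \<alpha>"
  define w where "w = g \<alpha> e - scale a e"
  have ee: "e + e = scale a (g (- \<alpha>) e) + scale b (g \<alpha> e)"
    using g_opposite[of e \<alpha> e] e by (simp add: a_def b_def)
  have "2 * 1 = 2 * (a * b)"
    using arg_cong[OF ee, of "\<lambda>v. \<phi> v \<alpha>"] e by (simp add: phi_simps a_def[symmetric] b_def[symmetric])
  then have ab: "a * b = 1" by (simp only: mult_cancel_left) simp
  then have ba: "b * a = 1" by (simp add: mult.commute)
  have w: "\<phi> w \<alpha> = 0" by (simp add: w_def phi_simps e a_def)
  have kernel: "g \<alpha> k = scale a k" "g (- \<alpha>) k = scale b k" if k: "\<phi> k \<alpha> = 0" for k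
  proof -
    have "k = scale b (g \<alpha> k)"
      using g_opposite[of k \<alpha> e] k e g_kernel[OF k] by (simp add: b_def)
    then have "scale a k = scale a (scale b (g \<alpha> k))" by (rule arg_cong)
    then show "g \<alpha> k = scale a k" by (simp add: ab)
    have "\<phi> (g (- \<alpha>) k) \<alpha> = 0" using g_kernel[of k "- \<alpha>"] k by (simp add: phi_simps)
    then have "k = scale a (g (- \<alpha>) k)"
      using g_opposite[of e \<alpha> k] k e by (simp add: a_def)
    then have "scale b k = scale b (scale a (g (- \<alpha>) k))" by (rule arg_cong)
    then show "g (- \<alpha>) k = scale b k" by (simp add: ba)
  qed
  have ge: "g \<alpha> e = scale a e + w" by (simp add: w_def)
  have "scale b (e + e) = scale b (scale a (g (- \<alpha>) e) + scale b (g \<alpha> e))" by (simp only: ee)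
  then have "scale b e + scale b e = g (- \<alpha>) e + scale b (scale b (scale a e) + scale b w)"
    by (simp add: scale_right_distrib ba ge)
  also have "scale b (scale b (scale a e) + scale b w) = scale b e + scale (b * b) w"
    by (simp only: scale_right_distrib scale_scale ba mult.assoc mult_1_right)
  finally have ge': "g (- \<alpha>) e = scale b e - scale (b * b) w"
    by (simp add: algebra_simps)
  have decomp: "d = (d - scale (\<phi> d \<alpha>) e) + scale (\<phi> d \<alpha>) e" for d by simp
  have k: "\<phi> (d - scale (\<phi> d \<alpha>) e) \<alpha> = 0" for d by (simp add: phi_simps e)
  have "g \<alpha> d = scale a d + scale (\<phi> d \<alpha>) w" for d
  proof -
    have "g \<alpha> d = scale a (d - scale (\<phi> d \<alpha>) e) + scale (\<phi> d \<alpha>) (scale a e + w)"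
      using g_add[of \<alpha> "d - scale (\<phi> d \<alpha>) e" "scale (\<phi> d \<alpha>) e"] kernel(1)[OF k, of d]
      by (simp add: g_scale ge)
    then show ?thesis by (simp add: scale_right_distrib scale_right_diff_distrib mult.commute)
  qed
  moreover have "g (- \<alpha>) d = scale b d - scale (\<phi> d \<alpha> * b * b) w" for d
  proof -
    have "g (- \<alpha>) d = scale b (d - scale (\<phi> d \<alpha>) e) + scale (\<phi> d \<alpha>) (scale b e - scale (b * b) w)"
      using g_add[of "- \<alpha>" "d - scale (\<phi> d \<alpha>) e" "scale (\<phi> d \<alpha>) e"] kernel(2)[OF k, of d]
      by (simp add: g_scale ge')
    then show ?thesis by (simp add: scale_right_diff_distrib mult.commute mult.left_commute mult.assoc)
  qed
  ultimately show ?thesis using ab w by blast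
qed

text \<open>The brackets \<open>[t\<^sup>\<alpha> p, t\<^sup>\<beta> p]\<close>, \<open>[t\<^sup>\<beta> q, t\<^sup>\<alpha> q]\<close> and \<open>[t\<^sup>\<alpha> p, t\<^sup>\<beta> q]\<close> compute \<open>g\<^sub>\<alpha>\<^sub>+\<^sub>\<beta>\<close> at \<open>p\<close>, \<open>q\<close> and
  \<open>q - p\<close>. Additivity then forces a skew relation between the two transvection vectors.\<close>

lemma g_transvection_skew:
  assumes \<alpha>: "\<And>d. g \<alpha> d = scale a d + scale (\<phi> d \<alpha>) w" "\<phi> w \<alpha> = 0"
    and \<beta>: "\<And>d. g \<beta> d = scale a' d + scale (\<phi> d \<beta>) w'" "\<phi> w' \<beta> = 0"
    and p: "\<phi> p \<alpha> = 0" "\<phi> p \<beta> = 1"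
    and q: "\<phi> q \<alpha> = 1" "\<phi> q \<beta> = 0"
  shows "a' * \<phi> w \<beta> = - a * \<phi> w' \<alpha>"
proof -
  have 1: "\<phi> (g (\<alpha> + \<beta>) p) \<alpha> = a * \<phi> w' \<alpha>"
    using arg_cong[OF g_bracket[of \<alpha> \<beta> p p], of "\<lambda>v. \<phi> v \<alpha>"]
    by (simp add: phi_simps \<alpha> \<beta> p)
  have 2: "\<phi> (g (\<alpha> + \<beta>) q) \<alpha> = a' * a - a' * \<phi> w \<beta>"
    using arg_cong[OF g_bracket[of \<beta> \<alpha> q q], of "\<lambda>v. \<phi> v \<alpha>"]
    by (simp add: phi_simps \<alpha> \<beta> q add.commute mult.commute)
  have 3: "\<phi> (g (\<alpha> + \<beta>) (q - p)) \<alpha> = a * a'"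
    using arg_cong[OF g_bracket[of \<alpha> \<beta> p q], of "\<lambda>v. \<phi> v \<alpha>"]
    by (simp add: phi_simps \<alpha> \<beta> p q)
  show ?thesis using 1 2 3 by (simp add: g_diff phi_diff algebra_simps add_eq_0_iff)
qed

text \<open>The skew relations for \<open>\<beta>\<close> and for \<open>- \<beta>\<close> have opposite signs, so the transvection vector pairs
  to \<open>0\<close> with every degree and vanishes.\<close>

lemma g_scalar: "\<exists>c. \<forall>d. g \<alpha> d = scale c d"
proof (cases "\<alpha> = 0")
  case True
  then show ?thesis by (metis g_zero_degree scale_one)
next
  case False
  obtain a b w where \<alpha>: "\<phi> w \<alpha> = 0" "\<And>d. g \<alpha> d = scale a d + scale (\<phi> d \<alpha>) w"
    using g_scaled_transvection[OF False] by blast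
  have "\<phi> w \<beta> = 0" for \<beta>
  proof (cases "\<exists>p. \<phi> p \<alpha> = 0 \<and> \<phi> p \<beta> \<noteq> 0")
    case False
    with \<alpha>(1) show ?thesis by blast
  next
    case True
    then obtain p0 where p0: "\<phi> p0 \<alpha> = 0" "\<phi> p0 \<beta> \<noteq> 0" by blast
    define p where "p = scale (inverse (\<phi> p0 \<beta>)) p0"
    have p: "\<phi> p \<alpha> = 0" "\<phi> p \<beta> = 1" using p0 by (simp_all add: p_def phi_simps)
    then have "\<beta> \<noteq> 0" by (auto simp: phi_0_right)
    obtain e where e: "\<phi> e \<alpha> = 1" using \<open>\<alpha> \<noteq> 0\<close> by (rule obtain_pairing_one)
    define q where "q = e - scale (\<phi> e \<beta>) p"
    have q: "\<phi> q \<alpha> = 1" "\<phi> q \<beta> = 0" by (simp_all add: q_def phi_simps p e)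
    obtain a' b' w' where ab': "a' * b' = 1" and w': "\<phi> w' \<beta> = 0"
      and \<beta>: "\<And>d. g \<beta> d = scale a' d + scale (\<phi> d \<beta>) w'"
      and \<beta>': "\<And>d. g (- \<beta>) d = scale b' d - scale (\<phi> d \<beta> * b' * b') w'"
      using g_scaled_transvection[OF \<open>\<beta> \<noteq> 0\<close>] by blast
    have 1: "a' * \<phi> w \<beta> = - a * \<phi> w' \<alpha>"
      by (rule g_transvection_skew[OF \<alpha>(2,1) \<beta> w' p q])
    have "b' * \<phi> w (- \<beta>) = - a * \<phi> (scale (b' * b') w') \<alpha>"
    proof (rule g_transvection_skew[OF \<alpha>(2,1)])
      show "g (- \<beta>) d = scale b' d + scale (\<phi> d (- \<beta>)) (scale (b' * b') w')" for d
        by (simp add: \<beta>' phi_simps mult.assoc)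
      show "\<phi> (scale (b' * b') w') (- \<beta>) = 0" "\<phi> (- p) \<alpha> = 0" "\<phi> (- p) (- \<beta>) = 1"
        "\<phi> q \<alpha> = 1" "\<phi> q (- \<beta>) = 0"
        using w' p q by (simp_all add: phi_simps)
    qed
    then have "a' * a' * (b' * \<phi> w \<beta>) = a' * a' * (a * (b' * b' * \<phi> w' \<alpha>))"
      by (simp add: phi_simps)
    then have "(a' * b') * a' * \<phi> w \<beta> = (a' * b') * (a' * b') * a * \<phi> w' \<alpha>"
      by (simp only: ac_simps)
    then have 2: "a' * \<phi> w \<beta> = a * \<phi> w' \<alpha>" by (simp add: ab')
    from 1 2 have "2 * (a' * \<phi> w \<beta>) = 0" by simp
    then show ?thesis using ab' by auto
  qed
  then have "w = 0" by (rule nondegenerate_left)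
  then show ?thesis using \<alpha>(2) by auto
qed

lemma g_character:
  obtains \<chi> where "\<And>\<alpha> d. g \<alpha> d = scale (\<chi> \<alpha>) d" "\<And>\<alpha> \<beta>. \<chi> (\<alpha> + \<beta>) = \<chi> \<alpha> * \<chi> \<beta>"
    "\<And>\<alpha>. \<chi> \<alpha> \<noteq> 0"
proof -
  obtain \<chi> where \<chi>: "\<And>\<alpha> d. g \<alpha> d = scale (\<chi> \<alpha>) d" using g_scalar by metis
  obtain d0 :: 't where d0: "d0 \<noteq> 0" using nontrivial by blast
  have \<chi>0: "\<chi> 0 = 1" using g_zero_degree[of d0] d0 by (simp add: \<chi>) (metis scale_cancel_right scale_one)
  have nz: "\<chi> \<alpha> \<noteq> 0" for \<alpha> using g_inj[of \<alpha> d0] d0 by (auto simp: \<chi>)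
  have distinct: "\<chi> (\<alpha> + \<beta>) = \<chi> \<alpha> * \<chi> \<beta>" if "\<alpha> \<noteq> \<beta>" for \<alpha> \<beta>
  proof -
    obtain d where "\<phi> d \<alpha> \<noteq> \<phi> d \<beta>"
    proof (rule ccontr)
      assume "\<not> thesis"
      with that have "\<phi> d \<alpha> = \<phi> d \<beta>" for d by blast
      then have "\<alpha> = \<beta>" by (rule eq_right)
      with \<open>\<alpha> \<noteq> \<beta>\<close> show False by blast
    qed
    then have d: "\<phi> d \<beta> - \<phi> d \<alpha> \<noteq> 0" and "d \<noteq> 0" by (auto simp: phi_0)
    have "scale (\<chi> (\<alpha> + \<beta>) * (\<phi> d \<beta> - \<phi> d \<alpha>)) d = scale (\<chi> \<alpha> * \<chi> \<beta> * (\<phi> d \<beta> - \<phi> d \<alpha>)) d"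
      using g_bracket[of \<alpha> \<beta> d d]
      by (simp add: \<chi> phi_simps scale_left_diff_distrib scale_right_diff_distrib
          right_diff_distrib ac_simps)
    with d \<open>d \<noteq> 0\<close> show ?thesis by simp
  qed
  have "\<chi> (\<alpha> + \<alpha>) = \<chi> \<alpha> * \<chi> \<alpha>" for \<alpha>
  proof (cases "\<alpha> = 0")
    case True
    then show ?thesis by (simp add: \<chi>0)
  next
    case False
    (* If T is one-dimensional, all brackets within degree alpha vanish; so reach 2 alpha
       through alpha = 2 alpha + (- alpha). *)
    have "\<alpha> \<noteq> - \<alpha>" "\<alpha> + \<alpha> \<noteq> - \<alpha>"
      using torsion_free[of 2 \<alpha>] torsion_free[of 3 \<alpha>] False
      by (auto simp: numeral_2_eq_2 numeral_3_eq_3 eq_neg_iff_add_eq_0 add.assoc)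
    then have "\<chi> \<alpha> * \<chi> (- \<alpha>) = 1" "\<chi> \<alpha> = \<chi> (\<alpha> + \<alpha>) * \<chi> (- \<alpha>)"
      using distinct[of \<alpha> "- \<alpha>"] distinct[of "\<alpha> + \<alpha>" "- \<alpha>"] \<chi>0 by auto
    then show ?thesis by (metis mult.assoc mult.commute mult_1_right)
  qed
  with distinct have "\<chi> (\<alpha> + \<beta>) = \<chi> \<alpha> * \<chi> \<beta>" for \<alpha> \<beta> by metis
  then show thesis using that \<chi> nz by blast
qed

end

definition character :: "('a::ab_group_add \<Rightarrow> 'f::field) \<Rightarrow> bool" where
  "character \<chi> \<longleftrightarrow> (\<forall>\<alpha> \<beta>. \<chi> (\<alpha> + \<beta>) = \<chi> \<alpha> * \<chi> \<beta>) \<and> (\<forall>\<alpha>. \<chi> \<alpha> \<noteq> 0)"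

context nondegenerate_witt_datum
begin

definition monomial_map ::
  "('a \<Rightarrow> 'f) \<Rightarrow> ('a \<Rightarrow> 'a) \<Rightarrow> ('t \<Rightarrow> 't) \<Rightarrow> (('a \<Rightarrow>\<^sub>0 't) \<Rightarrow> ('a \<Rightarrow>\<^sub>0 't)) \<Rightarrow> bool" where
  "monomial_map \<chi> \<sigma> \<tau> \<theta> \<longleftrightarrow>
    character \<chi> \<and> bij \<sigma> \<and> (\<forall>\<alpha> \<beta>. \<sigma> (\<alpha> + \<beta>) = \<sigma> \<alpha> + \<sigma> \<beta>) \<and> bij \<tau> \<and>
    (\<forall>d \<alpha>. \<phi> (\<tau> d) (\<sigma> \<alpha>) = \<phi> d \<alpha>) \<and>
    (\<forall>x \<alpha>. Poly_Mapping.lookup (\<theta> x) (\<sigma> \<alpha>) = scale (\<chi> \<alpha>) (\<tau> (Poly_Mapping.lookup x \<alpha>)))"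

text \<open>Adjointness under a nondegenerate pairing makes a map linear.\<close>

lemma pairing_linear:
  assumes "bij \<sigma>" and \<tau>: "\<And>d \<alpha>. \<phi> (\<tau> d) (\<sigma> \<alpha>) = \<phi> d \<alpha>"
  shows "\<tau> (d + e) = \<tau> d + \<tau> e" "\<tau> (scale c d) = scale c (\<tau> d)" "\<tau> 0 = 0"
    "\<tau> (d - e) = \<tau> d - \<tau> e"
proof -
  have eqI: "v = w" if "\<And>\<alpha>. \<phi> v (\<sigma> \<alpha>) = \<phi> w (\<sigma> \<alpha>)" for v w
    by (rule eq_left) (metis \<open>bij \<sigma>\<close> bij_pointE that)
  show "\<tau> (d + e) = \<tau> d + \<tau> e" "\<tau> (scale c d) = scale c (\<tau> d)" "\<tau> 0 = 0"
    "\<tau> (d - e) = \<tau> d - \<tau> e"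
    by (rule eqI, simp add: phi_simps \<tau>)+
qed

lemma additive_0:
  fixes \<sigma> :: "'a \<Rightarrow> 'a"
  assumes "\<And>\<alpha> \<beta>. \<sigma> (\<alpha> + \<beta>) = \<sigma> \<alpha> + \<sigma> \<beta>"
  shows "\<sigma> 0 = 0"
  using assms[of 0 0] by simp

theorem automorphism_monomial:
  assumes \<theta>: "lie_automorphism wscale wbr \<theta>"
  obtains \<chi> \<sigma> \<tau> where "monomial_map \<chi> \<sigma> \<tau> \<theta>"
proof -
  obtain \<sigma> \<tau> where single: "\<And>\<alpha> d. \<theta> (Poly_Mapping.single \<alpha> d)
      = Poly_Mapping.single (\<sigma> \<alpha>) (Poly_Mapping.lookup (\<theta> (Poly_Mapping.single \<alpha> d)) (\<sigma> \<alpha>))"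
    and torus: "\<And>d. \<theta> (Poly_Mapping.single 0 d) = Poly_Mapping.single 0 (\<tau> d)"
    and pairing: "\<And>d \<alpha>. \<phi> (\<tau> d) (\<sigma> \<alpha>) = \<phi> d \<alpha>" and bij: "bij \<tau>" "bij \<sigma>"
    and add: "\<And>\<alpha> \<beta>. \<sigma> (\<alpha> + \<beta>) = \<sigma> \<alpha> + \<sigma> \<beta>"
    using automorphism_weight_spaces[OF \<theta>] by blast
  note lin = pairing_linear[of \<sigma> \<tau>, OF bij(2) pairing]
  have \<sigma>0: "\<sigma> 0 = 0" using add by (rule additive_0)
  have \<tau>_inv: "\<tau> (inv \<tau> d) = d" for d using bij by (simp add: bij_is_surj surj_f_inv_f)
  have inj: "\<tau> d = \<tau> e \<longleftrightarrow> d = e" for d e using bij by (simp add: bij_is_inj inj_eq)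
  (* Divide out the permutation of weight spaces, to be left with a degree-preserving map. *)
  define g where "g \<alpha> d = inv \<tau> (Poly_Mapping.lookup (\<theta> (Poly_Mapping.single \<alpha> d)) (\<sigma> \<alpha>))" for \<alpha> d
  have g: "\<theta> (Poly_Mapping.single \<alpha> d) = Poly_Mapping.single (\<sigma> \<alpha>) (\<tau> (g \<alpha> d))" for \<alpha> d
    unfolding g_def \<tau>_inv by (rule single)
  have single_eq: "u = v" if "Poly_Mapping.single \<alpha> u = Poly_Mapping.single \<alpha> v" for \<alpha> :: 'a and u v :: 't
    using that by (metis lookup_single_eq)
  have gI: "g \<alpha> d = v" if "\<theta> (Poly_Mapping.single \<alpha> d) = Poly_Mapping.single (\<sigma> \<alpha>) (\<tau> v)" for \<alpha> d v
    using single_eq[of "\<sigma> \<alpha>" "\<tau> (g \<alpha> d)" "\<tau> v"] that inj by (simp add: g)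
  interpret degree_preserving_twist scale \<phi> g
  proof unfold_locales
    show "g \<alpha> (d + e) = g \<alpha> d + g \<alpha> e" for \<alpha> d e
      by (rule gI) (simp add: single_add automorphism_simps[OF \<theta>] g lin)
    show "g \<alpha> (scale c d) = scale c (g \<alpha> d)" for \<alpha> c d
      by (rule gI) (simp add: automorphism_simps[OF \<theta>] g lin witt_scale_single flip: witt_scale_single)
    show "d = 0" if "g \<alpha> d = 0" for \<alpha> d
    proof (rule single_eq)
      have "\<theta> (Poly_Mapping.single \<alpha> d) = \<theta> (Poly_Mapping.single \<alpha> 0)"
        using that by (simp add: g lin automorphism_simps(4)[OF \<theta>] del: automorphism_simps(6))
      then show "Poly_Mapping.single \<alpha> d = Poly_Mapping.single \<alpha> 0"
        by (simp only: automorphism_simps(6)[OF \<theta>])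
    qed
    show "g 0 d = d" for d by (rule gI) (simp add: torus \<sigma>0)
    show "g (\<alpha> + \<beta>) (scale (\<phi> d \<beta>) e - scale (\<phi> e \<alpha>) d)
      = scale (\<phi> (g \<alpha> d) \<beta>) (g \<beta> e) - scale (\<phi> (g \<beta> e) \<alpha>) (g \<alpha> d)" for \<alpha> \<beta> d e
      by (rule gI, subst bracket_single[symmetric], subst automorphism_simps(3)[OF \<theta>])
        (simp add: g bracket_single lin pairing add)
  qed
  obtain \<chi> where \<chi>: "\<And>\<alpha> d. g \<alpha> d = scale (\<chi> \<alpha>) d" "\<And>\<alpha> \<beta>. \<chi> (\<alpha> + \<beta>) = \<chi> \<alpha> * \<chi> \<beta>" "\<And>\<alpha>. \<chi> \<alpha> \<noteq> 0"
    by (rule g_character) blast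
  have "Poly_Mapping.lookup (\<theta> x) (\<sigma> \<alpha>) = scale (\<chi> \<alpha>) (\<tau> (Poly_Mapping.lookup x \<alpha>))" for x \<alpha>
  proof (induction x rule: poly_mapping_add_induct)
    case zero
    then show ?case by (simp add: automorphism_simps[OF \<theta>] lin)
  next
    case (add \<beta> d x)
    have "\<sigma> \<beta> = \<sigma> \<alpha> \<longleftrightarrow> \<beta> = \<alpha>" using bij by (simp add: bij_is_inj inj_eq)
    with add show ?case
      by (simp add: automorphism_simps[OF \<theta>] g \<chi> lin lookup_add lookup_single when_def
          scale_right_distrib)
  qed
  with \<chi>(2,3) bij add pairing have "monomial_map \<chi> \<sigma> \<tau> \<theta>" by (simp add: monomial_map_def character_def)
  then show thesis by (rule that)
qed

lemma monomial_map_automorphism: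
  assumes \<theta>: "monomial_map \<chi> \<sigma> \<tau> \<theta>" and "bij \<theta>"
  shows "lie_automorphism wscale wbr \<theta>"
proof -
  have \<chi>: "\<And>\<alpha> \<beta>. \<chi> (\<alpha> + \<beta>) = \<chi> \<alpha> * \<chi> \<beta>" and bij: "bij \<sigma>"
    and \<sigma>: "\<And>\<alpha> \<beta>. \<sigma> (\<alpha> + \<beta>) = \<sigma> \<alpha> + \<sigma> \<beta>" and pairing: "\<And>d \<alpha>. \<phi> (\<tau> d) (\<sigma> \<alpha>) = \<phi> d \<alpha>"
    and lookup: "\<And>x \<alpha>. Poly_Mapping.lookup (\<theta> x) (\<sigma> \<alpha>) = scale (\<chi> \<alpha>) (\<tau> (Poly_Mapping.lookup x \<alpha>))"
    using \<theta> by (auto simp: monomial_map_def character_def)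
  note lin = pairing_linear[of \<sigma> \<tau>, OF bij pairing]
  have eqI: "x = y" if "\<And>\<alpha>. Poly_Mapping.lookup x (\<sigma> \<alpha>) = Poly_Mapping.lookup y (\<sigma> \<alpha>)" for x y :: "'a \<Rightarrow>\<^sub>0 't"
    by (rule poly_mapping_eqI) (metis bij bij_pointE that)
  have inj: "\<sigma> \<beta> = \<sigma> \<alpha> \<longleftrightarrow> \<beta> = \<alpha>" for \<alpha> \<beta> using bij by (simp add: bij_is_inj inj_eq)
  have add: "\<theta> (x + y) = \<theta> x + \<theta> y" for x y
    by (rule eqI) (simp add: lookup lookup_add lin scale_right_distrib)
  have scale: "\<theta> (wscale c x) = wscale c (\<theta> x)" for c x
    by (rule eqI) (simp add: lookup lin mult.commute)
  have zero: "\<theta> 0 = 0" by (rule eqI) (simp add: lookup lin)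
  have single: "\<theta> (Poly_Mapping.single \<alpha> d) = Poly_Mapping.single (\<sigma> \<alpha>) (scale (\<chi> \<alpha>) (\<tau> d))" for \<alpha> d
    by (rule eqI) (simp add: lookup lin lookup_single when_def inj)
  have "\<theta> (wbr x y) = wbr (\<theta> x) (\<theta> y)" for x y
  proof (induction x rule: poly_mapping_add_induct)
    case (add \<alpha> d x)
    have "\<theta> (wbr (Poly_Mapping.single \<alpha> d) y) = wbr (\<theta> (Poly_Mapping.single \<alpha> d)) (\<theta> y)"
    proof (induction y rule: poly_mapping_add_induct)
      case (add \<beta> e y)
      have "\<theta> (wbr (Poly_Mapping.single \<alpha> d) (Poly_Mapping.single \<beta> e))
          = wbr (\<theta> (Poly_Mapping.single \<alpha> d)) (\<theta> (Poly_Mapping.single \<beta> e))"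
        by (simp add: single bracket_single lin \<chi> \<sigma> phi_simps pairing scale_right_diff_distrib
            mult.commute mult.left_commute)
      with add show ?case by (simp add: bracket_add_right \<open>\<And>x y. \<theta> (x + y) = \<theta> x + \<theta> y\<close>)
    qed (simp add: zero)
    with add show ?case by (simp add: bracket_add_left \<open>\<And>x y. \<theta> (x + y) = \<theta> x + \<theta> y\<close>)
  qed (simp add: zero)
  with add scale \<open>bij \<theta>\<close> show ?thesis
    unfolding lie_automorphism_def Vector_Spaces.linear_iff
    by (intro conjI allI vector_space_witt_scale) auto
qed

end

section \<open>Two-local automorphisms\<close>

context nondegenerate_witt_datum
begin

lemma monomial_mapD:
  assumes "monomial_map \<chi> \<sigma> \<tau> \<theta>"
  shows "\<chi> 0 = 1" "\<chi> \<alpha> \<noteq> 0" "bij \<sigma>" "\<sigma> 0 = 0" "\<phi> (\<tau> d) (\<sigma> \<alpha>) = \<phi> d \<alpha>"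
    "\<tau> d = 0 \<longleftrightarrow> d = 0"
    "Poly_Mapping.lookup (\<theta> x) (\<sigma> \<alpha>) = scale (\<chi> \<alpha>) (\<tau> (Poly_Mapping.lookup x \<alpha>))"
    "Poly_Mapping.lookup (\<theta> x) 0 = \<tau> (Poly_Mapping.lookup x 0)"
    "Poly_Mapping.keys (\<theta> x) = \<sigma> ` Poly_Mapping.keys x"
proof -
  note defs = assms[unfolded monomial_map_def character_def]
  show \<chi>: "\<chi> \<alpha> \<noteq> 0" for \<alpha> using defs by blast
  have "\<chi> (0 + 0) = \<chi> 0 * \<chi> 0" using defs by blast
  with \<chi>[of 0] show \<chi>0: "\<chi> 0 = 1" by simp
  show bij: "bij \<sigma>" using defs by blast
  show pairing: "\<phi> (\<tau> d) (\<sigma> \<alpha>) = \<phi> d \<alpha>" for d \<alpha> using defs by blast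
  show \<sigma>0: "\<sigma> 0 = 0" using defs by (intro additive_0) blast
  have "\<tau> 0 = 0" using pairing_linear(3)[of \<sigma> \<tau>, OF bij pairing] .
  moreover have "bij \<tau>" using defs by blast
  ultimately show \<tau>: "\<tau> d = 0 \<longleftrightarrow> d = 0" for d by (metis bij_pointE)
  show lookup: "Poly_Mapping.lookup (\<theta> x) (\<sigma> \<alpha>) = scale (\<chi> \<alpha>) (\<tau> (Poly_Mapping.lookup x \<alpha>))" for \<alpha>
    using defs by blast
  from this[of 0] show "Poly_Mapping.lookup (\<theta> x) 0 = \<tau> (Poly_Mapping.lookup x 0)"
    by (simp add: \<sigma>0 \<chi>0)
  have key: "\<sigma> \<alpha> \<in> Poly_Mapping.keys (\<theta> x) \<longleftrightarrow> \<alpha> \<in> Poly_Mapping.keys x" for \<alpha>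
    by (simp add: in_keys_iff lookup \<tau> \<chi>)
  show "Poly_Mapping.keys (\<theta> x) = \<sigma> ` Poly_Mapping.keys x"
  proof (intro equalityI subsetI)
    fix \<beta> assume "\<beta> \<in> Poly_Mapping.keys (\<theta> x)"
    moreover obtain \<alpha> where "\<beta> = \<sigma> \<alpha>" using bij by (metis bij_pointE)
    ultimately show "\<beta> \<in> \<sigma> ` Poly_Mapping.keys x" using key by simp
  qed (auto simp: key)
qed

definition probe :: "'a set \<Rightarrow> 't \<Rightarrow> ('a \<Rightarrow>\<^sub>0 't)" where
  "probe Z d = (\<Sum>\<alpha>\<in>Z. Poly_Mapping.single \<alpha> d)"

lemma lookup_probe:
  "finite Z \<Longrightarrow> Poly_Mapping.lookup (probe Z d) \<alpha> = (if \<alpha> \<in> Z then d else 0)"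
  by (simp add: probe_def lookup_sum lookup_single when_def)

lemma keys_probe: "finite Z \<Longrightarrow> d \<noteq> 0 \<Longrightarrow> Poly_Mapping.keys (probe Z d) = Z"
  by (auto simp: in_keys_iff lookup_probe split: if_splits)

text \<open>One degree determines the only possible factor, a second one refutes it if \<open>v\<close> is not a multiple
  of \<open>u\<close>.\<close>

lemma proportionality_test:
  assumes "u \<noteq> 0"
  shows "\<exists>Z. finite Z \<and> (\<forall>k. (\<forall>\<alpha>\<in>Z. \<phi> v \<alpha> = k * \<phi> u \<alpha>) \<longrightarrow> v = scale k u)"
proof -
  have "\<exists>\<alpha>. \<phi> u \<alpha> \<noteq> 0" using assms nondegenerate_left by blast
  then obtain \<alpha> where \<alpha>: "\<phi> u \<alpha> \<noteq> 0" by blast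
  define c where "c = \<phi> v \<alpha> / \<phi> u \<alpha>"
  obtain \<beta> where \<beta>: "v = scale c u \<or> \<phi> v \<beta> \<noteq> \<phi> (scale c u) \<beta>"
    using eq_left[of v "scale c u"] by blast
  have "v = scale k u" if k: "\<forall>\<alpha>\<in>{\<alpha>, \<beta>}. \<phi> v \<alpha> = k * \<phi> u \<alpha>" for k
  proof -
    from k \<alpha> have "k = c" by (simp add: c_def)
    with k \<beta> show ?thesis by (simp add: phi_simps)
  qed
  then show ?thesis by (intro exI[of _ "{\<alpha>, \<beta>}"]) simp
qed

end

locale two_local_witt = nondegenerate_witt_datum scale \<phi>
  for scale :: "'f::field_char_0 \<Rightarrow> 't::ab_group_add \<Rightarrow> 't"
  and \<phi> :: "'t \<Rightarrow> 'a::ab_group_add \<Rightarrow> 'f" +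
  fixes \<Phi> :: "('a \<Rightarrow>\<^sub>0 't) \<Rightarrow> ('a \<Rightarrow>\<^sub>0 't)"
  assumes two_local: "two_local_automorphism wscale wbr \<Phi>"
    and bij_\<Phi>: "bij \<Phi>"
begin

lemma obtain_monomial:
  obtains \<chi> \<sigma> \<tau> \<theta> where "monomial_map \<chi> \<sigma> \<tau> \<theta>" "\<Phi> x = \<theta> x" "\<Phi> y = \<theta> y"
  using two_local automorphism_monomial unfolding two_local_automorphism_def by metis

definition torus_map :: "'t \<Rightarrow> 't" where
  "torus_map d = Poly_Mapping.lookup (\<Phi> (Poly_Mapping.single 0 d)) 0"

definition unit_vector :: 't where
  "unit_vector = (SOME d. d \<noteq> 0)"

definition degree_map :: "'a \<Rightarrow> 'a" where
  "degree_map \<alpha> = (SOME \<beta>. \<beta> \<in> Poly_Mapping.keys (\<Phi> (Poly_Mapping.single \<alpha> unit_vector)))"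

lemma unit_vector: "unit_vector \<noteq> 0"
  unfolding unit_vector_def using nontrivial by (rule someI_ex)

lemma \<Phi>_torus: "\<Phi> (Poly_Mapping.single 0 d) = Poly_Mapping.single 0 (torus_map d)"
proof -
  obtain \<chi> \<sigma> \<tau> \<theta> where m: "monomial_map \<chi> \<sigma> \<tau> \<theta>" "\<Phi> (Poly_Mapping.single 0 d) = \<theta> (Poly_Mapping.single 0 d)"
    using obtain_monomial .
  have "Poly_Mapping.keys (\<Phi> (Poly_Mapping.single 0 d)) \<subseteq> {0}"
    using monomial_mapD(4,9)[OF m(1)] by (auto simp: m(2) split: if_splits)
  then show ?thesis unfolding torus_map_def by (rule keys_subset_singletonD)
qed

lemma keys_\<Phi>_unit: "Poly_Mapping.keys (\<Phi> (Poly_Mapping.single \<alpha> unit_vector)) = {degree_map \<alpha>}"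
proof -
  obtain \<chi> \<sigma> \<tau> \<theta> where m: "monomial_map \<chi> \<sigma> \<tau> \<theta>"
    "\<Phi> (Poly_Mapping.single \<alpha> unit_vector) = \<theta> (Poly_Mapping.single \<alpha> unit_vector)"
    using obtain_monomial .
  have "Poly_Mapping.keys (\<Phi> (Poly_Mapping.single \<alpha> unit_vector)) = {\<sigma> \<alpha>}"
    using monomial_mapD(9)[OF m(1)] unit_vector by (simp add: m(2))
  then show ?thesis by (simp add: degree_map_def)
qed

lemma degree_torus_pairing: "\<phi> (torus_map d) (degree_map \<alpha>) = \<phi> d \<alpha>"
proof -
  obtain \<chi> \<sigma> \<tau> \<theta> where m: "monomial_map \<chi> \<sigma> \<tau> \<theta>"
    "\<Phi> (Poly_Mapping.single 0 d) = \<theta> (Poly_Mapping.single 0 d)"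
    "\<Phi> (Poly_Mapping.single \<alpha> unit_vector) = \<theta> (Poly_Mapping.single \<alpha> unit_vector)"
    using obtain_monomial .
  have "torus_map d = \<tau> d" unfolding torus_map_def m(2) by (simp add: monomial_mapD(8)[OF m(1)])
  moreover have "degree_map \<alpha> = \<sigma> \<alpha>"
    using keys_\<Phi>_unit[of \<alpha>] monomial_mapD(9)[OF m(1)] unit_vector by (simp add: m(3))
  ultimately show ?thesis using monomial_mapD(5)[OF m(1)] by simp
qed

text \<open>Injectivity of \<open>torus_map\<close> and \<open>degree_map\<close> comes from nondegeneracy, surjectivity from that of
  \<open>\<Phi>\<close>: a preimage of a homogeneous element is homogeneous.\<close>

lemma bij_torus_map: "bij torus_map"
proof (rule bijI)
  show "inj torus_map" by (rule injI) (metis degree_torus_pairing eq_left)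
  show "surj torus_map"
  proof -
    have "\<exists>d. e = torus_map d" for e
    proof -
      obtain x where x: "\<Phi> x = Poly_Mapping.single 0 e" using bij_\<Phi> by (metis bij_pointE)
      obtain \<chi> \<sigma> \<tau> \<theta> where m: "monomial_map \<chi> \<sigma> \<tau> \<theta>" "\<Phi> x = \<theta> x" using obtain_monomial .
      have "\<sigma> ` Poly_Mapping.keys x = Poly_Mapping.keys (Poly_Mapping.single 0 e)"
        using monomial_mapD(9)[OF m(1), of x] x m(2) by simp
      also have "\<dots> \<subseteq> {\<sigma> 0}" by (simp add: monomial_mapD(4)[OF m(1)])
      finally have "\<sigma> \<alpha> = \<sigma> 0" if "\<alpha> \<in> Poly_Mapping.keys x" for \<alpha>
        using that by blast
      then have "Poly_Mapping.keys x \<subseteq> {0}"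
        using bij_is_inj[OF monomial_mapD(3)[OF m(1)]] by (auto dest: injD)
      then have "x = Poly_Mapping.single 0 (Poly_Mapping.lookup x 0)" by (rule keys_subset_singletonD)
      then obtain d where "x = Poly_Mapping.single 0 d" by blast
      with x have "Poly_Mapping.single (0::'a) e = Poly_Mapping.single 0 (torus_map d)"
        by (simp add: \<Phi>_torus)
      then show ?thesis by (metis lookup_single_eq)
    qed
    then show ?thesis by blast
  qed
qed

lemma bij_degree_map: "bij degree_map"
proof (rule bijI)
  show "inj degree_map" by (rule injI) (metis degree_torus_pairing eq_right)
  show "surj degree_map"
  proof -
    have "\<exists>\<alpha>. \<beta> = degree_map \<alpha>" for \<beta>
    proof -
      obtain x where x: "\<Phi> x = Poly_Mapping.single \<beta> unit_vector" using bij_\<Phi> by (metis bij_pointE)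
      obtain \<chi> \<sigma> \<tau> \<theta> where m: "monomial_map \<chi> \<sigma> \<tau> \<theta>" "\<Phi> x = \<theta> x" using obtain_monomial .
      have "\<sigma> ` Poly_Mapping.keys x = {\<beta>}"
        using monomial_mapD(9)[OF m(1), of x] x m(2) unit_vector by simp
      then obtain \<alpha> where \<alpha>: "\<alpha> \<in> Poly_Mapping.keys x" by blast
      obtain \<chi>' \<sigma>' \<tau>' \<theta>' where m': "monomial_map \<chi>' \<sigma>' \<tau>' \<theta>'" "\<Phi> x = \<theta>' x"
        "\<Phi> (Poly_Mapping.single \<alpha> unit_vector) = \<theta>' (Poly_Mapping.single \<alpha> unit_vector)"
        using obtain_monomial .
      have "\<sigma>' \<alpha> = \<beta>"
        using monomial_mapD(9)[OF m'(1), of x] \<alpha> x m'(2) unit_vector by auto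
      moreover have "\<sigma>' \<alpha> = degree_map \<alpha>"
        using keys_\<Phi>_unit[of \<alpha>] monomial_mapD(9)[OF m'(1)] unit_vector by (simp add: m'(3))
      ultimately show ?thesis by blast
    qed
    then show ?thesis by blast
  qed
qed

lemma torus_map_nonzero: "torus_map d = 0 \<longleftrightarrow> d = 0"
  using pairing_linear(3)[of degree_map torus_map, OF bij_degree_map degree_torus_pairing]
    bij_torus_map by (metis bij_pointE)

lemma degree_map_add: "degree_map (\<alpha> + \<beta>) = degree_map \<alpha> + degree_map \<beta>"
proof (rule eq_right)
  fix d
  obtain e where "d = torus_map e" using bij_torus_map by (metis bij_pointE)
  then show "\<phi> d (degree_map (\<alpha> + \<beta>)) = \<phi> d (degree_map \<alpha> + degree_map \<beta>)"
    by (simp add: degree_torus_pairing phi_simps)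
qed

text \<open>Pairing \<open>x\<close> with a torus element that separates the finitely many degrees involved pins down
  how \<open>\<Phi>\<close> moves the support of \<open>x\<close>.\<close>

lemma obtain_monomial_on_support:
  obtains \<chi> \<sigma> \<tau> \<theta> where "monomial_map \<chi> \<sigma> \<tau> \<theta>" "\<Phi> x = \<theta> x"
    "\<And>\<alpha>. \<alpha> \<in> Poly_Mapping.keys x \<Longrightarrow> \<sigma> \<alpha> = degree_map \<alpha>"
proof -
  let ?Z = "Poly_Mapping.keys (\<Phi> x) \<union> degree_map ` Poly_Mapping.keys x"
  obtain e where e: "inj_on (\<phi> e) ?Z" using generic_injective[of ?Z] by auto
  obtain d where d: "e = torus_map d" using bij_torus_map by (metis bij_pointE)
  obtain \<chi> \<sigma> \<tau> \<theta> where m: "monomial_map \<chi> \<sigma> \<tau> \<theta>" "\<Phi> x = \<theta> x"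
    "\<Phi> (Poly_Mapping.single 0 d) = \<theta> (Poly_Mapping.single 0 d)"
    using obtain_monomial .
  have \<tau>: "e = \<tau> d" unfolding d torus_map_def m(3) by (simp add: monomial_mapD(8)[OF m(1)])
  have "\<sigma> \<alpha> = degree_map \<alpha>" if \<alpha>: "\<alpha> \<in> Poly_Mapping.keys x" for \<alpha>
  proof (rule inj_onD[OF e])
    show "\<phi> e (\<sigma> \<alpha>) = \<phi> e (degree_map \<alpha>)"
      using monomial_mapD(5)[OF m(1), of d \<alpha>] degree_torus_pairing[of d \<alpha>] by (simp flip: \<tau> d)
    show "\<sigma> \<alpha> \<in> ?Z" using monomial_mapD(9)[OF m(1), of x] m(2) \<alpha> by simp
    show "degree_map \<alpha> \<in> ?Z" using \<alpha> by simp
  qed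
  with m(1,2) show thesis by (rule that)
qed

lemma keys_\<Phi>: "Poly_Mapping.keys (\<Phi> x) = degree_map ` Poly_Mapping.keys x"
proof -
  obtain \<chi> \<sigma> \<tau> \<theta> where m: "monomial_map \<chi> \<sigma> \<tau> \<theta>" "\<Phi> x = \<theta> x"
    and \<sigma>: "\<And>\<alpha>. \<alpha> \<in> Poly_Mapping.keys x \<Longrightarrow> \<sigma> \<alpha> = degree_map \<alpha>"
    using obtain_monomial_on_support by blast
  show ?thesis unfolding m(2) monomial_mapD(9)[OF m(1)] using \<sigma> by (intro image_cong) auto
qed

lemma lookup_\<Phi>_eq_0: "\<alpha> \<notin> Poly_Mapping.keys x \<Longrightarrow> Poly_Mapping.lookup (\<Phi> x) (degree_map \<alpha>) = 0"
  using keys_\<Phi>[of x] bij_is_inj[OF bij_degree_map] by (metis in_keys_iff inj_image_mem_iff)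

text \<open>A probe has equal generic coefficients in many degrees, including degree \<open>0\<close>. Any monomial map
  that agrees with \<open>\<Phi>\<close> on it permutes these degrees, and its value in degree \<open>0\<close> tells them
  apart.\<close>

lemma probe_rigid:
  assumes Z: "finite Z" "0 \<in> Z" and d: "inj_on (\<phi> d) Z" "d \<noteq> 0"
    and m: "monomial_map \<chi> \<sigma> \<tau> \<theta>" "\<Phi> (probe Z d) = \<theta> (probe Z d)" and "\<alpha> \<in> Z"
  shows "\<sigma> \<alpha> = degree_map \<alpha>"
proof -
  note keys = keys_probe[OF Z(1) d(2)]
  obtain \<chi>' \<sigma>' \<tau>' \<theta>' where m': "monomial_map \<chi>' \<sigma>' \<tau>' \<theta>'" "\<Phi> (probe Z d) = \<theta>' (probe Z d)"
    and \<sigma>': "\<And>\<alpha>. \<alpha> \<in> Poly_Mapping.keys (probe Z d) \<Longrightarrow> \<sigma>' \<alpha> = degree_map \<alpha>"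
    using obtain_monomial_on_support by blast
  have "Poly_Mapping.lookup (\<Phi> (probe Z d)) 0 = \<tau> d"
    unfolding m(2) monomial_mapD(8)[OF m(1)] using Z by (simp add: lookup_probe)
  moreover have "Poly_Mapping.lookup (\<Phi> (probe Z d)) 0 = \<tau>' d"
    unfolding m'(2) monomial_mapD(8)[OF m'(1)] using Z by (simp add: lookup_probe)
  ultimately have \<tau>: "\<tau> d = \<tau>' d" by simp
  have "\<sigma> \<alpha> \<in> Poly_Mapping.keys (\<Phi> (probe Z d))"
    using monomial_mapD(9)[OF m(1), of "probe Z d"] m(2) keys \<open>\<alpha> \<in> Z\<close> by simp
  then obtain \<beta> where \<beta>: "\<beta> \<in> Z" "\<sigma> \<alpha> = degree_map \<beta>"
    unfolding keys_\<Phi> keys by blast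
  have "\<phi> d \<alpha> = \<phi> (\<tau>' d) (\<sigma>' \<beta>)"
    using monomial_mapD(5)[OF m(1), of d \<alpha>] \<beta> \<sigma>' keys \<tau> by simp
  also have "\<dots> = \<phi> d \<beta>" by (rule monomial_mapD(5)[OF m'(1)])
  finally have "\<alpha> = \<beta>" using d(1) \<open>\<alpha> \<in> Z\<close> \<beta>(1) by (simp add: inj_on_eq_iff)
  with \<beta> show ?thesis by simp
qed

text \<open>The degrees in \<open>Z\<close> suffice to see that a coefficient of \<open>\<Phi> x\<close> is a given multiple of the
  expected one.\<close>

definition detects_coefficients :: "'a set \<Rightarrow> ('a \<Rightarrow>\<^sub>0 't) \<Rightarrow> bool" where
  "detects_coefficients Z x \<longleftrightarrow> (\<forall>\<beta>\<in>Poly_Mapping.keys x. \<forall>k.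
    (\<forall>\<alpha>\<in>Z. \<phi> (Poly_Mapping.lookup (\<Phi> x) (degree_map \<beta>)) (degree_map \<alpha>)
        = k * \<phi> (torus_map (Poly_Mapping.lookup x \<beta>)) (degree_map \<alpha>)) \<longrightarrow>
      Poly_Mapping.lookup (\<Phi> x) (degree_map \<beta>) = scale k (torus_map (Poly_Mapping.lookup x \<beta>)))"

lemma detects_coefficients_mono:
  "detects_coefficients Z x \<Longrightarrow> Z \<subseteq> Z' \<Longrightarrow> detects_coefficients Z' x"
  unfolding detects_coefficients_def by blast

definition acts_by :: "('a \<Rightarrow> 'f) \<Rightarrow> ('a \<Rightarrow>\<^sub>0 't) \<Rightarrow> bool" where
  "acts_by \<chi> x \<longleftrightarrow> (\<forall>\<beta>. Poly_Mapping.lookup (\<Phi> x) (degree_map \<beta>)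
    = scale (\<chi> \<beta>) (torus_map (Poly_Mapping.lookup x \<beta>)))"

lemma acts_byI:
  assumes "\<And>\<beta>. \<beta> \<in> Poly_Mapping.keys x \<Longrightarrow> Poly_Mapping.lookup (\<Phi> x) (degree_map \<beta>)
    = scale (\<chi> \<beta>) (torus_map (Poly_Mapping.lookup x \<beta>))"
  shows "acts_by \<chi> x"
  unfolding acts_by_def
proof
  fix \<beta>
  show "Poly_Mapping.lookup (\<Phi> x) (degree_map \<beta>) = scale (\<chi> \<beta>) (torus_map (Poly_Mapping.lookup x \<beta>))"
  proof (cases "\<beta> \<in> Poly_Mapping.keys x")
    case False
    then show ?thesis using torus_map_nonzero[of 0] by (simp add: lookup_\<Phi>_eq_0 in_keys_iff)
  qed (rule assms)
qed

text \<open>An automorphism that agrees with \<open>\<Phi>\<close> on \<open>x\<close> and on the probe moves the degrees in \<open>Z\<close> by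
  \<open>degree_map\<close>. By adjointness its torus part then looks like \<open>torus_map\<close> to these degrees, and they
  detect the coefficients of \<open>\<Phi> x\<close>. The second equation recovers the character from \<open>\<Phi>\<close> on the
  probe alone.\<close>

lemma probe_coefficients:
  assumes Z: "finite Z" "0 \<in> Z" "Poly_Mapping.keys x \<subseteq> Z"
    and d: "inj_on (\<phi> d) Z" "d \<noteq> 0"
    and test: "detects_coefficients Z x"
  shows "\<exists>\<chi>. character \<chi> \<and> acts_by \<chi> x \<and>
    (\<forall>\<beta>\<in>Z. Poly_Mapping.lookup (\<Phi> (probe Z d)) (degree_map \<beta>)
      = scale (\<chi> \<beta>) (Poly_Mapping.lookup (\<Phi> (probe Z d)) 0))"
proof -
  obtain \<chi> \<sigma> \<tau> \<theta> where m: "monomial_map \<chi> \<sigma> \<tau> \<theta>" "\<Phi> x = \<theta> x" "\<Phi> (probe Z d) = \<theta> (probe Z d)"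
    using obtain_monomial .
  have \<sigma>: "\<sigma> \<alpha> = degree_map \<alpha>" if "\<alpha> \<in> Z" for \<alpha>
    by (rule probe_rigid[OF Z(1,2) d m(1,3) that])
  have coeff: "Poly_Mapping.lookup (\<theta> y) (degree_map \<beta>) = scale (\<chi> \<beta>) (\<tau> (Poly_Mapping.lookup y \<beta>))"
    if "\<beta> \<in> Z" for y \<beta>
    using monomial_mapD(7)[OF m(1), of y \<beta>] \<sigma>[OF that] by simp
  have "acts_by \<chi> x"
  proof (rule acts_byI)
    fix \<beta> assume \<beta>: "\<beta> \<in> Poly_Mapping.keys x"
    then have "\<beta> \<in> Z" using Z(3) by blast
    show "Poly_Mapping.lookup (\<Phi> x) (degree_map \<beta>) = scale (\<chi> \<beta>) (torus_map (Poly_Mapping.lookup x \<beta>))"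
    proof (rule test[unfolded detects_coefficients_def, rule_format, OF \<beta>])
      fix \<alpha> assume "\<alpha> \<in> Z"
      then have "\<phi> (\<tau> u) (degree_map \<alpha>) = \<phi> u \<alpha>" for u
        using monomial_mapD(5)[OF m(1), of u \<alpha>] \<sigma> by simp
      then show "\<phi> (Poly_Mapping.lookup (\<Phi> x) (degree_map \<beta>)) (degree_map \<alpha>)
        = \<chi> \<beta> * \<phi> (torus_map (Poly_Mapping.lookup x \<beta>)) (degree_map \<alpha>)"
        unfolding m(2) coeff[OF \<open>\<beta> \<in> Z\<close>] by (simp add: phi_scale degree_torus_pairing)
    qed
  qed
  moreover have "\<forall>\<beta>\<in>Z. Poly_Mapping.lookup (\<Phi> (probe Z d)) (degree_map \<beta>)
      = scale (\<chi> \<beta>) (Poly_Mapping.lookup (\<Phi> (probe Z d)) 0)"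
    unfolding m(3) monomial_mapD(8)[OF m(1)] using Z by (simp add: coeff lookup_probe)
  moreover have "character \<chi>" using m(1) by (simp add: monomial_map_def)
  ultimately show ?thesis by blast
qed

lemma finite_detecting_set: "\<exists>Z. finite Z \<and> detects_coefficients Z x"
proof -
  define v where "v \<beta> = Poly_Mapping.lookup (\<Phi> x) (degree_map \<beta>)" for \<beta>
  define u where "u \<beta> = torus_map (Poly_Mapping.lookup x \<beta>)" for \<beta>
  have "\<exists>Z. finite Z \<and> (\<forall>k. (\<forall>\<alpha>\<in>Z. \<phi> (v \<beta>) \<alpha> = k * \<phi> (u \<beta>) \<alpha>) \<longrightarrow> v \<beta> = scale k (u \<beta>))"
    if "\<beta> \<in> Poly_Mapping.keys x" for \<beta>
    using that by (intro proportionality_test) (simp add: u_def torus_map_nonzero in_keys_iff)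
  then obtain Z where Z: "\<And>\<beta>. \<beta> \<in> Poly_Mapping.keys x \<Longrightarrow> finite (Z \<beta>)"
    "\<And>\<beta> k. \<beta> \<in> Poly_Mapping.keys x \<Longrightarrow> (\<And>\<alpha>. \<alpha> \<in> Z \<beta> \<Longrightarrow> \<phi> (v \<beta>) \<alpha> = k * \<phi> (u \<beta>) \<alpha>)
      \<Longrightarrow> v \<beta> = scale k (u \<beta>)"
    by metis
  define Z' where "Z' = inv degree_map ` (\<Union>\<beta>\<in>Poly_Mapping.keys x. Z \<beta>)"
  have "finite Z'" using Z(1) by (simp add: Z'_def)
  moreover have "v \<beta> = scale k (u \<beta>)"
    if \<beta>: "\<beta> \<in> Poly_Mapping.keys x"
      and eq: "\<forall>\<alpha>\<in>Z'. \<phi> (v \<beta>) (degree_map \<alpha>) = k * \<phi> (u \<beta>) (degree_map \<alpha>)" for \<beta> k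
  proof (rule Z(2)[OF \<beta>])
    fix \<alpha> assume "\<alpha> \<in> Z \<beta>"
    then have "inv degree_map \<alpha> \<in> Z'" using \<beta> by (auto simp: Z'_def)
    then show "\<phi> (v \<beta>) \<alpha> = k * \<phi> (u \<beta>) \<alpha>"
      using eq bij_degree_map by (metis bij_is_surj surj_f_inv_f)
  qed
  ultimately show ?thesis unfolding detects_coefficients_def u_def v_def by blast
qed

text \<open>Comparing \<open>x\<close> and \<open>y\<close> with one common probe yields one character that serves both.\<close>

lemma common_character: "\<exists>\<chi>. character \<chi> \<and> acts_by \<chi> x \<and> acts_by \<chi> y"
proof -
  obtain X where X: "finite X" "detects_coefficients X x"
    using finite_detecting_set[of x] by blast
  obtain Y where Y: "finite Y" "detects_coefficients Y y"
    using finite_detecting_set[of y] by blast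
  define Z where "Z = {0} \<union> Poly_Mapping.keys x \<union> Poly_Mapping.keys y \<union> X \<union> Y"
  have Z: "finite Z" "0 \<in> Z" "Poly_Mapping.keys x \<subseteq> Z" "Poly_Mapping.keys y \<subseteq> Z"
    using X(1) Y(1) by (auto simp: Z_def)
  have test: "detects_coefficients Z x" "detects_coefficients Z y"
    by (rule detects_coefficients_mono[OF X(2)], force simp: Z_def)
      (rule detects_coefficients_mono[OF Y(2)], force simp: Z_def)
  obtain d' where d': "inj_on (\<phi> d') Z" using Z(1) by (rule generic_injective)
  (* For Z = {0} any vector is generic, even 0, which would make the probe vanish. *)
  obtain d where d: "inj_on (\<phi> d) Z" "d \<noteq> 0"
  proof (cases "d' = 0")
    case True
    then have "inj_on (\<phi> unit_vector) Z" using d' by (auto simp: inj_on_def phi_0)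
    then show thesis using unit_vector that by blast
  qed (use d' that in blast)
  define v where "v = Poly_Mapping.lookup (\<Phi> (probe Z d)) 0"
  have "0 \<in> Poly_Mapping.keys (\<Phi> (probe Z d))"
    unfolding keys_\<Phi> keys_probe[OF Z(1) d(2)]
    using Z(2) additive_0[of degree_map, OF degree_map_add] by force
  then have v: "v \<noteq> 0" by (simp add: v_def in_keys_iff)
  obtain \<chi> where \<chi>: "character \<chi>" "acts_by \<chi> x"
    "\<And>\<beta>. \<beta> \<in> Z \<Longrightarrow> Poly_Mapping.lookup (\<Phi> (probe Z d)) (degree_map \<beta>) = scale (\<chi> \<beta>) v"
    using probe_coefficients[OF Z(1,2,3) d test(1)] unfolding v_def by blast
  obtain \<chi>' where \<chi>': "acts_by \<chi>' y"
    "\<And>\<beta>. \<beta> \<in> Z \<Longrightarrow> Poly_Mapping.lookup (\<Phi> (probe Z d)) (degree_map \<beta>) = scale (\<chi>' \<beta>) v"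
    using probe_coefficients[OF Z(1,2,4) d test(2)] unfolding v_def by blast
  have "acts_by \<chi> y"
  proof (rule acts_byI)
    fix \<beta> assume "\<beta> \<in> Poly_Mapping.keys y"
    then have "scale (\<chi> \<beta>) v = scale (\<chi>' \<beta>) v" using \<chi>(3)[of \<beta>] \<chi>'(2)[of \<beta>] Z(4) by auto
    with v have "\<chi> \<beta> = \<chi>' \<beta>" by simp
    with \<chi>'(1) show "Poly_Mapping.lookup (\<Phi> y) (degree_map \<beta>) = scale (\<chi> \<beta>) (torus_map (Poly_Mapping.lookup y \<beta>))"
      by (simp add: acts_by_def)
  qed
  with \<chi>(1,2) show ?thesis by blast
qed

text \<open>The characters obtained for different pairs need not coincide, but each is determined on the
  supports of its pair. So its value at \<open>\<alpha>\<close> is the one read off from \<open>t\<^sup>\<alpha> d\<close>, whatever the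
  pair.\<close>

theorem two_local_monomial: "\<exists>\<chi>. monomial_map \<chi> degree_map torus_map \<Phi>"
proof -
  have agree: "\<chi> \<alpha> = \<chi>' \<alpha>"
    if "acts_by \<chi> x" "acts_by \<chi>' x" "\<alpha> \<in> Poly_Mapping.keys x" for \<chi> \<chi>' x \<alpha>
  proof -
    have "torus_map (Poly_Mapping.lookup x \<alpha>) \<noteq> 0"
      using that(3) by (simp add: torus_map_nonzero in_keys_iff)
    moreover have "scale (\<chi> \<alpha>) (torus_map (Poly_Mapping.lookup x \<alpha>))
        = scale (\<chi>' \<alpha>) (torus_map (Poly_Mapping.lookup x \<alpha>))"
      using that(1,2) unfolding acts_by_def by metis
    ultimately show ?thesis by simp
  qed
  let ?t = "\<lambda>\<alpha>. Poly_Mapping.single \<alpha> unit_vector"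
  have key: "\<alpha> \<in> Poly_Mapping.keys (?t \<alpha>)" for \<alpha> using unit_vector by simp
  have "\<exists>\<chi>. character \<chi> \<and> acts_by \<chi> (?t \<alpha>)" for \<alpha> using common_character by blast
  then obtain \<chi>t where \<chi>t: "\<And>\<alpha>. character (\<chi>t \<alpha>)" "\<And>\<alpha>. acts_by (\<chi>t \<alpha>) (?t \<alpha>)" by metis
  define c where "c \<alpha> = \<chi>t \<alpha> \<alpha>" for \<alpha>
  have c: "\<chi> \<alpha> = c \<alpha>" if \<chi>: "acts_by \<chi> x" and \<alpha>: "\<alpha> \<in> Poly_Mapping.keys x" for \<chi> x \<alpha>
  proof -
    obtain \<chi>' where "acts_by \<chi>' x" "acts_by \<chi>' (?t \<alpha>)" using common_character[of x "?t \<alpha>"] by blast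
    with agree[OF \<chi> _ \<alpha>] agree[OF _ \<chi>t(2) key] show ?thesis by (simp add: c_def)
  qed
  have acts: "acts_by c x" for x
  proof -
    obtain \<chi> where "acts_by \<chi> x" using common_character[of x x] by blast
    with c[OF this] show ?thesis by (intro acts_byI) (simp add: acts_by_def)
  qed
  have "c (\<alpha> + \<beta>) = c \<alpha> * c \<beta>" for \<alpha> \<beta>
  proof -
    (* An element with all three degrees in its support sees the character law. *)
    let ?x = "probe {\<alpha>, \<beta>, \<alpha> + \<beta>} unit_vector"
    obtain \<chi> where \<chi>: "character \<chi>" "acts_by \<chi> ?x" using common_character[of ?x ?x] by blast
    have "Poly_Mapping.keys ?x = {\<alpha>, \<beta>, \<alpha> + \<beta>}" using unit_vector by (simp add: keys_probe)
    with c[OF \<chi>(2)] have "\<chi> \<alpha> = c \<alpha>" "\<chi> \<beta> = c \<beta>" "\<chi> (\<alpha> + \<beta>) = c (\<alpha> + \<beta>)" by auto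
    with \<chi>(1) show ?thesis unfolding character_def by metis
  qed
  moreover have "c \<alpha> \<noteq> 0" for \<alpha> using \<chi>t(1)[of \<alpha>] by (simp add: c_def character_def)
  ultimately have "character c" by (simp add: character_def)
  with acts show ?thesis
    unfolding monomial_map_def acts_by_def
    using bij_degree_map degree_map_add bij_torus_map degree_torus_pairing by blast
qed

end

theorem theorem3p3:
  fixes scale :: "'f::field_char_0 \<Rightarrow> 't::ab_group_add \<Rightarrow> 't"
    and \<phi> :: "'t \<Rightarrow> 'a::ab_group_add \<Rightarrow> 'f"
    and \<Phi> :: "('a \<Rightarrow>\<^sub>0 't) \<Rightarrow> ('a \<Rightarrow>\<^sub>0 't)"
  assumes "witt_datum scale \<phi>"
    and "simple_lie_algebra (witt_scale scale :: 'f \<Rightarrow> ('a \<Rightarrow>\<^sub>0 't) \<Rightarrow> ('a \<Rightarrow>\<^sub>0 't))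
      (witt_bracket scale \<phi>)"
    and "two_local_automorphism (witt_scale scale) (witt_bracket scale \<phi>) \<Phi>"
    and "bij \<Phi>"
  shows "lie_automorphism (witt_scale scale) (witt_bracket scale \<phi>) \<Phi>"
proof -
  interpret nondegenerate_witt_datum scale \<phi>
    using assms(1,2) by (rule simple_imp_nondegenerate_witt_datum)
  interpret two_local_witt scale \<phi> \<Phi>
    using assms(3,4) by unfold_locales
  show ?thesis using two_local_monomial monomial_map_automorphism[OF _ assms(4)] by blast
qed

end
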